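(* Let $(M,g)$ be a Riemannian manifold of dimension $n\ge3$ with scale tractor $I$, and let $\Sigma$ be a submanifold of dimension $m$ and codimension $d=n-m$, $1\le m\le n-1$. Then $\Sigma$ is minimal (i.e. $H^a=0$) if and only if one of the following equivalent conditions holds along $\Sigma$: 1. $I^AN_A^B=0$; 2. $I^{A_1}N_{A_1A_2\cdots A_d}=0$; 3. $I^{[A_0}\star N^{A_1A_2\cdots A_{m+2}]}=0$; 4. $I\in\Gamma(\mathcal{N}^\perp)$; 5. $H^AI_A=0$.
   Context: Tractors. Let $\boldsymbol{c}=[g]$, $M$ connected and oriented. Sections of the density bundle $\mathcal{E}[w]$ are classes of pairs $(g,f)\sim(\Omega^2g,\Omega^wf)$; $\mathcal{B}[w]:=\mathcal{B}\otimes\mathcal{E}[w]$; the conformal metric $\boldsymbol{g}\in\Gamma(S^2T^*M[2])$ is the class of $(g,g)$ and raises and lowers indices. For a metric in $\boldsymbol{c}$, $\nabla$ is the Levi-Civita connection, $R_{ab}$ the Ricci tensor (positive on spheres), $P_{ab}$ is defined by $R_{ab}=(n-2)P_{ab}+J\boldsymbol{g}_{ab}$, $J=\boldsymbol{g}^{ab}P_{ab}$, $\Delta=\nabla^a\nabla_a$. The standard tractor bundle $\mathcal{T}$ is identified by a metric in $\boldsymbol{c}$ with $\mathcal{E}[1]\oplus T^*M[1]\oplus\mathcal{E}[-1]$, $V=(\sigma,\mu_a,\rho)$; for $\hat g=\Omega^2g$, $\Upsilon_a=\Omega^{-1}\nabla_a\Omega$, the triple becomes $(\sigma,\mu_a+\Upsilon_a\sigma,\rho-\Upsilon^b\mu_b-\tfrac12\Upsilon^b\Upsilon_b\sigma)$.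 The invariant tractor metric $h(V,V)=2\sigma\rho+\boldsymbol{g}^{ab}\mu_a\mu_b$ identifies $\mathcal{T}\cong\mathcal{T}^*$. $\star$ is the Hodge star of $h$ and the orientation (with tractor volume form $\varepsilon$, $\varepsilon^{A_1\cdots A_{n+2}}\varepsilon_{A_1\cdots A_{n+2}}=-(n+2)!$). Scale tractor. Let $\sigma\in\Gamma(\mathcal{E}[1])$ be the positive density with $g=\sigma^{-2}\boldsymbol{g}$. The scale tractor of $g$ is $I=(\sigma,\ \nabla_a\sigma,\ -\tfrac1n(\Delta+J)\sigma)$; in the splitting by $g$ itself, $I=(\sigma,0,-\tfrac1nJ\sigma)$. Submanifold objects. $\Sigma$ is smoothly embedded and oriented, with mean curvature $H^a=\frac1m\boldsymbol{g}^{ij}I\!I_{ij}{}^a$ ($I\!I$ the second fundamental form for $g$). The map $N_a^A:N\Sigma[-1]\to\mathcal{T}|_\Sigma$, $n^a\mapsto(0,n_a,n_cH^c)$ is conformally invariant; its image is the normal tractor bundle $\mathcal{N}$; $N_A^B$ denotes the orthogonal projection onto $\mathcal{N}$ and $\mathcal{N}^\perp$ its orthogonal complement. $N_{A_1\cdots A_d}$ is the section of $\Lambda^d\mathcal{N}^*$ compatible with the orientations with $N^{A_1\cdots A_d}N_{A_1\cdots A_d}=d!$. The mean curvature tractor is $H^A:=\sigma N_a^AH^a\in\Gamma(\mathcal{N})$, with $\sigma$ and $H^a$ those of $g$. *)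

theory Defs
  imports "HOL-Analysis.Analysis"
begin

section \<open>Smooth oriented manifolds\<close>

primrec Ck_on :: "nat \<Rightarrow> 'a::real_normed_vector set \<Rightarrow> ('a \<Rightarrow> 'b::real_normed_vector) \<Rightarrow> bool" where
  "Ck_on 0 U f \<longleftrightarrow> continuous_on U f"
| "Ck_on (Suc k) U f \<longleftrightarrow>
     (\<forall>x\<in>U. f differentiable (at x)) \<and> (\<forall>v. Ck_on k U (\<lambda>x. frechet_derivative f (at x) v))"

text \<open>Only used for open sets \<open>U\<close>.\<close>

definition smooth_on :: "'a::real_normed_vector set \<Rightarrow> ('a \<Rightarrow> 'b::real_normed_vector) \<Rightarrow> bool" where
  "smooth_on U f \<longleftrightarrow> (\<forall>k. Ck_on k U f)"

definition pd :: "'n \<Rightarrow> (real^'n::finite \<Rightarrow> 'b::real_normed_vector) \<Rightarrow> real^'n \<Rightarrow> 'b" where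
  "pd i f x = frechet_derivative f (at x) (axis i 1)"

definition jacobian :: "(real^'k::finite \<Rightarrow> real^'n::finite) \<Rightarrow> real^'k \<Rightarrow> real^'k^'n" where
  "jacobian f x = matrix (frechet_derivative f (at x))"

text \<open>A chart is a pair of its domain and its coordinate map.\<close>

type_synonym ('a, 'n) chart = "'a set \<times> ('a \<Rightarrow> real^'n)"

definition chart_inv :: "('a, 'n::finite) chart \<Rightarrow> real^'n \<Rightarrow> 'a" where
  "chart_inv c = inv_into (fst c) (snd c)"

definition is_chart :: "'a topology \<Rightarrow> ('a, 'n::finite) chart \<Rightarrow> bool" where
  "is_chart M c \<longleftrightarrow> openin M (fst c) \<and> open (snd c ` fst c) \<and>
     homeomorphic_map (subtopology M (fst c)) (top_of_set (snd c ` fst c)) (snd c)"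

text \<open>A smooth manifold is given by a (not necessarily maximal) smooth atlas; an orientation
  is given by requiring all coordinate changes to have positive Jacobian determinant.\<close>

definition oriented_manifold :: "'a topology \<Rightarrow> ('a, 'n::finite) chart set \<Rightarrow> bool" where
  "oriented_manifold M A \<longleftrightarrow>
     Hausdorff_space M \<and> second_countable M \<and>
     (\<forall>c\<in>A. is_chart M c) \<and> (\<Union>c\<in>A. fst c) = topspace M \<and>
     (\<forall>c\<in>A. \<forall>c'\<in>A.
        smooth_on (snd c ` (fst c \<inter> fst c')) (snd c' \<circ> chart_inv c) \<and>
        (\<forall>x\<in>snd c ` (fst c \<inter> fst c'). det (jacobian (snd c' \<circ> chart_inv c) x) > 0))"

text \<open>The map expressing the inclusion of a submanifold in a chart \<open>c\<close> of the ambient manifold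
  and a chart \<open>s\<close> of the submanifold.\<close>

definition inclusion_in :: "('a, 'n::finite) chart \<Rightarrow> ('a, 'm::finite) chart \<Rightarrow> real^'m \<Rightarrow> real^'n" where
  "inclusion_in c s = snd c \<circ> chart_inv s"

text \<open>An embedded submanifold carries the subspace topology, and its inclusion is a smooth
  immersion.\<close>

definition oriented_submanifold ::
  "'a topology \<Rightarrow> ('a, 'n::finite) chart set \<Rightarrow> 'a set \<Rightarrow> ('a, 'm::finite) chart set \<Rightarrow> bool" where
  "oriented_submanifold M A S AS \<longleftrightarrow>
     S \<subseteq> topspace M \<and> oriented_manifold (subtopology M S) AS \<and>
     (\<forall>c\<in>A. \<forall>s\<in>AS.
        smooth_on (snd s ` (fst s \<inter> fst c)) (inclusion_in c s) \<and>
        (\<forall>y\<in>snd s ` (fst s \<inter> fst c). inj (frechet_derivative (inclusion_in c s) (at y))))"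

section \<open>Riemannian metrics and conformal weights\<close>

text \<open>A metric is given by its matrix of components, a function of the coordinates, in each
  chart.\<close>

type_synonym ('a, 'n) metric = "('a, 'n) chart \<Rightarrow> real^'n \<Rightarrow> real^'n^'n"

definition bil :: "real^'i^'i \<Rightarrow> real^'i \<Rightarrow> real^'i::finite \<Rightarrow> real" where
  "bil B u v = u \<bullet> (B *v v)"

definition riemannian_metric :: "('a, 'n::finite) chart set \<Rightarrow> ('a, 'n) metric \<Rightarrow> bool" where
  "riemannian_metric A g \<longleftrightarrow>
     (\<forall>c\<in>A. smooth_on (snd c ` fst c) (g c) \<and>
        (\<forall>x\<in>snd c ` fst c. transpose (g c x) = g c x \<and> (\<forall>v. v \<noteq> 0 \<longrightarrow> bil (g c x) v v > 0))) \<and>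
     (\<forall>c\<in>A. \<forall>c'\<in>A. \<forall>p\<in>fst c \<inter> fst c'.
        (let D = jacobian (snd c' \<circ> chart_inv c) (snd c p)
         in g c (snd c p) = transpose D ** g c' (snd c' p) ** D))"

text \<open>The metrics conformal to \<open>g\<close> are the \<open>\<Omega>\<^sup>2 g\<close>, for \<open>\<Omega>\<close> as follows.\<close>

definition conformal_factor :: "'a topology \<Rightarrow> ('a, 'n::finite) chart set \<Rightarrow> ('a \<Rightarrow> real) \<Rightarrow> bool" where
  "conformal_factor M A \<Omega> \<longleftrightarrow>
     (\<forall>p\<in>topspace M. \<Omega> p > 0) \<and> (\<forall>c\<in>A. smooth_on (snd c ` fst c) (\<Omega> \<circ> chart_inv c))"

text \<open>A section of a bundle of weight \<open>w\<close> is a class of pairs \<open>(g, f) \<sim> (\<Omega>\<^sup>2 g, \<Omega>\<^sup>w f)\<close>. The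
  following is the value which represents at \<open>p\<close>, in the scale \<open>\<Omega>\<^sup>2 g\<close>, the class of \<open>(g, f)\<close>
  with \<open>f p = v\<close>.\<close>

definition weight_rep :: "int \<Rightarrow> ('a \<Rightarrow> real) \<Rightarrow> 'a \<Rightarrow> 'b::real_vector \<Rightarrow> 'b" where
  "weight_rep w \<Omega> p v = (\<Omega> p powi w) *\<^sub>R v"

text \<open>The conformal metric is the class of \<open>(g, g)\<close>, of weight 2, so that its representative
  in the scale \<open>\<Omega>\<^sup>2 g\<close> is \<open>\<Omega>\<^sup>2 g\<close> itself.\<close>

definition rescaled :: "('a \<Rightarrow> real) \<Rightarrow> ('a, 'n::finite) metric \<Rightarrow> ('a, 'n) metric" where
  "rescaled \<Omega> g = (\<lambda>c x. weight_rep 2 \<Omega> (chart_inv c x) (g c x))"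

text \<open>The density \<open>\<sigma>\<close> of weight 1 with \<open>g = \<sigma>\<^sup>-\<^sup>2\<close> times the conformal metric: it is represented by
  1 in the scale \<open>g\<close>, hence by \<open>\<Omega>\<close> in the scale \<open>\<Omega>\<^sup>2 g\<close>.\<close>

definition scale_density :: "('a \<Rightarrow> real) \<Rightarrow> 'a \<Rightarrow> real" where
  "scale_density \<Omega> p = weight_rep 1 \<Omega> p 1"

section \<open>Curvature in local coordinates\<close>

type_synonym 'n coords = "real^'n"
type_synonym 'n metric_matrix = "real^'n \<Rightarrow> real^'n^'n"
type_synonym ('m, 'n) parametrization = "real^'m \<Rightarrow> real^'n"

text \<open>In this and the following sections \<open>G\<close> is the matrix of components of a metric in a chart,
  and \<open>x\<close> is a point in the image of the chart.\<close>

definition christoffel :: "'n::finite metric_matrix \<Rightarrow> 'n coords \<Rightarrow> 'n \<Rightarrow> 'n \<Rightarrow> 'n \<Rightarrow> real" where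
  "christoffel G x k i j = (1/2) * (\<Sum>l\<in>UNIV. matrix_inv (G x) $ k $ l *
     (pd i (\<lambda>z. G z $ j $ l) x + pd j (\<lambda>z. G z $ i $ l) x - pd l (\<lambda>z. G z $ i $ j) x))"

definition ricci :: "'n::finite metric_matrix \<Rightarrow> 'n coords \<Rightarrow> real^'n^'n" where
  "ricci G x = (\<chi> i j. \<Sum>k\<in>UNIV.
     pd k (\<lambda>z. christoffel G z k i j) x - pd j (\<lambda>z. christoffel G z k i k) x +
     (\<Sum>l\<in>UNIV. christoffel G x k k l * christoffel G x l i j
             - christoffel G x k j l * christoffel G x l i k))"

definition metric_trace :: "real^'n^'n \<Rightarrow> real^'n^'n::finite \<Rightarrow> real" where
  "metric_trace B P = (\<Sum>a\<in>UNIV. \<Sum>b\<in>UNIV. matrix_inv B $ a $ b * P $ a $ b)"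

definition schouten :: "'n::finite metric_matrix \<Rightarrow> 'n coords \<Rightarrow> real^'n^'n" where
  "schouten G x = (THE P. ricci G x =
     (real CARD('n) - 2) *\<^sub>R P + metric_trace (G x) P *\<^sub>R G x)"

definition J_curv :: "'n::finite metric_matrix \<Rightarrow> 'n coords \<Rightarrow> real" where
  "J_curv G x = metric_trace (G x) (schouten G x)"

definition laplacian :: "'n::finite metric_matrix \<Rightarrow> ('n coords \<Rightarrow> real) \<Rightarrow> 'n coords \<Rightarrow> real" where
  "laplacian G f x = metric_trace (G x)
     (\<chi> a b. pd a (pd b f) x - (\<Sum>k\<in>UNIV. christoffel G x k a b * pd k f x))"

section \<open>Standard tractors\<close>

text \<open>The components of a tractor \<open>(\<sigma>, \<mu>\<^sub>a, \<rho>)\<close> in the splitting by a metric, all weighted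
  quantities being represented in the scale of this metric.\<close>

datatype 'n tidx = Tsig | Tmu 'n | Trho

instance tidx :: (finite) finite
proof
  have "(UNIV :: 'a tidx set) \<subseteq> {Tsig, Trho} \<union> range Tmu"
    by (metis UnI1 UnI2 insertI1 insertI2 rangeI singletonI subsetI tidx.exhaust)
  then show "finite (UNIV :: 'a tidx set)"
    by (rule finite_subset) simp
qed

type_synonym 'n tractor = "real^('n tidx)"
type_synonym 'n tractor_matrix = "real^('n tidx)^('n tidx)"

text \<open>The components in the splitting by \<open>\<Omega>\<^sup>2 g\<close> of the tractor with components \<open>V\<close> in the
  splitting by \<open>g\<close>; here \<open>\<omega>\<close> is \<open>\<Omega>\<close> in coordinates. The slots have weights \<open>1, 1, -1\<close>, which
  accounts for the factors \<open>\<omega>, \<omega>, 1 / \<omega>\<close>.\<close>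

definition tractor_change ::
  "'n::finite metric_matrix \<Rightarrow> ('n coords \<Rightarrow> real) \<Rightarrow> 'n coords \<Rightarrow> 'n tractor \<Rightarrow> 'n tractor" where
  "tractor_change G \<omega> x V =
    (let \<Upsilon> = (\<chi> a. pd a \<omega> x / \<omega> x); \<mu> = (\<chi> a. V $ Tmu a); Gi = matrix_inv (G x)
     in (\<chi> K. case K of
           Tsig \<Rightarrow> \<omega> x * V $ Tsig
         | Tmu a \<Rightarrow> \<omega> x * (\<mu> $ a + \<Upsilon> $ a * V $ Tsig)
         | Trho \<Rightarrow> (V $ Trho - bil Gi \<Upsilon> \<mu> - (1/2) * bil Gi \<Upsilon> \<Upsilon> * V $ Tsig) / \<omega> x))"

text \<open>The matrix \<open>h\<^sub>A\<^sub>B\<close> of the tractor metric.\<close>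

definition tractor_metric :: "'n::finite metric_matrix \<Rightarrow> 'n coords \<Rightarrow> 'n tractor_matrix" where
  "tractor_metric G x = (\<chi> K L. case (K, L) of
       (Tsig, Trho) \<Rightarrow> 1
     | (Trho, Tsig) \<Rightarrow> 1
     | (Tmu a, Tmu b) \<Rightarrow> matrix_inv (G x) $ a $ b
     | _ \<Rightarrow> 0)"

definition scale_tractor_split ::
  "'n::finite metric_matrix \<Rightarrow> ('n coords \<Rightarrow> real) \<Rightarrow> 'n coords \<Rightarrow> 'n tractor" where
  "scale_tractor_split G \<sigma> x = (\<chi> K. case K of
       Tsig \<Rightarrow> \<sigma> x
     | Tmu a \<Rightarrow> pd a \<sigma> x
     | Trho \<Rightarrow> - (1 / real CARD('n)) * (laplacian G \<sigma> x + J_curv G x * \<sigma> x))"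

text \<open>The scale tractor of \<open>g\<close> in the splitting by \<open>\<Omega>\<^sup>2 g\<close>: its components in the splitting by
  \<open>g\<close> itself, transformed.\<close>

definition scale_tractor ::
  "('a, 'n::finite) metric \<Rightarrow> ('a \<Rightarrow> real) \<Rightarrow> ('a, 'n) chart \<Rightarrow> 'a \<Rightarrow> 'n tractor" where
  "scale_tractor g \<Omega> c p =
     tractor_change (g c) (\<Omega> \<circ> chart_inv c) (snd c p)
       (scale_tractor_split (g c) (scale_density (\<lambda>_. 1) \<circ> chart_inv c) (snd c p))"

section \<open>Submanifolds in local coordinates\<close>

text \<open>\<open>F\<close> is a local parametrization of the submanifold in the coordinates of the ambient
  manifold, \<open>y\<close> a point of its domain.\<close>

definition orth_proj :: "real^'i^'i \<Rightarrow> (real^'i) set \<Rightarrow> real^'i \<Rightarrow> real^'i::finite" where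
  "orth_proj B E v = (THE w. w \<in> E \<and> (\<forall>u\<in>E. bil B (v - w) u = 0))"

definition tangent_space :: "('m::finite, 'n::finite) parametrization \<Rightarrow> 'm coords \<Rightarrow> 'n coords set" where
  "tangent_space F y = span (range (\<lambda>i. pd i F y))"

definition normal_space ::
  "'n::finite metric_matrix \<Rightarrow> ('m::finite, 'n) parametrization \<Rightarrow> 'm coords \<Rightarrow> 'n coords set" where
  "normal_space G F y = {v. \<forall>u\<in>tangent_space F y. bil (G (F y)) v u = 0}"

text \<open>The induced metric, and the second fundamental form: the normal part of the covariant
  derivative of the coordinate vector field \<open>\<partial>\<^sub>j F\<close> along \<open>\<partial>\<^sub>i F\<close>.\<close>

definition first_ff ::
  "'n::finite metric_matrix \<Rightarrow> ('m::finite, 'n) parametrization \<Rightarrow> 'm coords \<Rightarrow> real^'m^'m" where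
  "first_ff G F y = (\<chi> i j. bil (G (F y)) (pd i F y) (pd j F y))"

definition second_ff ::
  "'n::finite metric_matrix \<Rightarrow> ('m::finite, 'n) parametrization \<Rightarrow> 'm coords \<Rightarrow> 'm \<Rightarrow> 'm \<Rightarrow> 'n coords" where
  "second_ff G F y i j = orth_proj (G (F y)) (normal_space G F y)
     (\<chi> k. pd i (\<lambda>z. pd j F z $ k) y +
        (\<Sum>a\<in>UNIV. \<Sum>b\<in>UNIV. christoffel G (F y) k a b * pd i F y $ a * pd j F y $ b))"

definition mean_curvature ::
  "'n::finite metric_matrix \<Rightarrow> ('m::finite, 'n) parametrization \<Rightarrow> 'm coords \<Rightarrow> 'n coords" where
  "mean_curvature G F y = (1 / real CARD('m)) *\<^sub>R
     (\<Sum>i\<in>UNIV. \<Sum>j\<in>UNIV. matrix_inv (first_ff G F y) $ i $ j *\<^sub>R second_ff G F y i j)"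

text \<open>The map from weighted normal vectors to tractors, \<open>n\<^sup>a \<mapsto> (0, n\<^sub>a, n\<^sub>c H\<^sup>c)\<close>, in the splitting
  by \<open>G\<close>, with the mean curvature of \<open>G\<close>.\<close>

definition normal_to_tractor ::
  "'n::finite metric_matrix \<Rightarrow> ('m::finite, 'n) parametrization \<Rightarrow> 'm coords \<Rightarrow> 'n coords \<Rightarrow> 'n tractor" where
  "normal_to_tractor G F y v = (\<chi> K. case K of
       Tsig \<Rightarrow> 0
     | Tmu a \<Rightarrow> (G (F y) *v v) $ a
     | Trho \<Rightarrow> bil (G (F y)) v (mean_curvature G F y))"

definition normal_tractors ::
  "'n::finite metric_matrix \<Rightarrow> ('m::finite, 'n) parametrization \<Rightarrow> 'm coords \<Rightarrow> ('n tractor) set" where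
  "normal_tractors G F y = normal_to_tractor G F y ` normal_space G F y"

definition normal_tractors_perp ::
  "'n::finite metric_matrix \<Rightarrow> ('m::finite, 'n) parametrization \<Rightarrow> 'm coords \<Rightarrow> ('n tractor) set" where
  "normal_tractors_perp G F y =
     {V. \<forall>W\<in>normal_tractors G F y. bil (tractor_metric G (F y)) V W = 0}"

definition normal_tractor_proj ::
  "'n::finite metric_matrix \<Rightarrow> ('m::finite, 'n) parametrization \<Rightarrow> 'm coords \<Rightarrow> 'n tractor \<Rightarrow> 'n tractor" where
  "normal_tractor_proj G F y = orth_proj (tractor_metric G (F y)) (normal_tractors G F y)"

text \<open>The tractor \<open>\<sigma> N\<^sub>a\<^sup>A H\<^sup>a\<close> in the splitting by \<open>\<Omega>\<^sup>2 g\<close>, with \<open>\<sigma>\<close> and \<open>H\<^sup>a\<close> those of \<open>g\<close>. As the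
  inverse of the conformal metric has weight -2, so has \<open>H\<^sup>a\<close>.\<close>

definition mean_curvature_tractor ::
  "('a, 'n::finite) metric \<Rightarrow> ('a \<Rightarrow> real) \<Rightarrow> ('a, 'n) chart \<Rightarrow> ('a, 'm::finite) chart \<Rightarrow> 'a \<Rightarrow> 'n tractor" where
  "mean_curvature_tractor g \<Omega> c s p =
     (let F = inclusion_in c s; y = snd s p
      in normal_to_tractor (rescaled \<Omega> g c) F y
           (scale_density \<Omega> p *\<^sub>R weight_rep (-2) \<Omega> p (mean_curvature (g c) F y)))"

section \<open>Tensors by components\<close>

text \<open>A tensor with \<open>k\<close> indices is a function on index lists, of which only the values on lists
  of length \<open>k\<close> matter.\<close>

type_synonym 'i tensor = "'i list \<Rightarrow> real"

definition tensor_eval :: "'i tensor \<Rightarrow> (real^'i::finite) list \<Rightarrow> real" where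
  "tensor_eval T Vs =
     (\<Sum>K | length K = length Vs. T K * (\<Prod>k<length Vs. Vs ! k $ (K ! k)))"

definition raise_all :: "real^'i^'i \<Rightarrow> 'i tensor \<Rightarrow> 'i::finite tensor" where
  "raise_all h T K =
     (\<Sum>L | length L = length K. (\<Prod>k<length K. matrix_inv h $ (K ! k) $ (L ! k)) * T L)"

definition permute_indices :: "(nat \<Rightarrow> nat) \<Rightarrow> 'i list \<Rightarrow> 'i list" where
  "permute_indices \<pi> K = map (\<lambda>k. K ! \<pi> k) [0..<length K]"

definition alternating :: "nat \<Rightarrow> 'i tensor \<Rightarrow> bool" where
  "alternating k T \<longleftrightarrow>
     (\<forall>K \<pi>. length K = k \<longrightarrow> \<pi> permutes {..<k} \<longrightarrow> T (permute_indices \<pi> K) = of_int (sign \<pi>) * T K)"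

definition skew :: "nat \<Rightarrow> 'i tensor \<Rightarrow> 'i tensor" where
  "skew k T K = (1 / fact k) *
     (\<Sum>\<pi> | \<pi> permutes {..<k}. of_int (sign \<pi>) * T (permute_indices \<pi> K))"

section \<open>Volume form, Hodge star, and the normal tractor form\<close>

text \<open>The order on the coordinate indices only serves to number them \<open>0, \<dots>, n - 1\<close>, so that an
  ordered frame has a determinant.\<close>

definition index_pos :: "'n::{finite,linorder} \<Rightarrow> nat" where
  "index_pos i = card {k. k < i}"

definition frame_det :: "'n::{finite,linorder} coords list \<Rightarrow> real" where
  "frame_det vs = det (\<chi> i. vs ! index_pos i)"

fun tidx_pos :: "'n::{finite,linorder} tidx \<Rightarrow> nat" where
  "tidx_pos Tsig = 0"
| "tidx_pos (Tmu i) = Suc (index_pos i)"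
| "tidx_pos Trho = Suc CARD('n)"

definition levi_civita :: "'n::{finite,linorder} tidx tensor" where
  "levi_civita K = det (\<chi> i j. if K ! tidx_pos i = j then 1 else (0::real))"

text \<open>The tractor volume form with lower indices, for a chart of the oriented atlas. Since
  \<open>det h < 0\<close>, its square is \<open>-(n + 2)!\<close>.\<close>

definition tractor_volume :: "'n::{finite,linorder} tractor_matrix \<Rightarrow> 'n tidx tensor" where
  "tractor_volume h K = sqrt \<bar>det h\<bar> * levi_civita K"

text \<open>The Hodge star of a \<open>d\<close>-form \<open>T\<close>, with upper indices.\<close>

definition hodge_star ::
  "'n::{finite,linorder} tractor_matrix \<Rightarrow> nat \<Rightarrow> 'n tidx tensor \<Rightarrow> 'n tidx tensor" where
  "hodge_star h d T K =
     (1 / fact d) * (\<Sum>L | length L = d. raise_all h (tractor_volume h) (L @ K) * T L)"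

text \<open>A normal frame is oriented if, preceded by an oriented tangent frame, it is an oriented
  frame of the ambient manifold.\<close>

definition oriented_normal_frame ::
  "'n::{finite,linorder} metric_matrix \<Rightarrow> ('m::{finite,linorder}, 'n) parametrization \<Rightarrow> 'm coords
     \<Rightarrow> 'n coords list \<Rightarrow> bool" where
  "oriented_normal_frame G F y vs \<longleftrightarrow>
     length vs = CARD('n) - CARD('m) \<and> set vs \<subseteq> normal_space G F y \<and>
     frame_det (map (\<lambda>i. pd i F y) (sorted_list_of_set UNIV) @ vs) > 0"

text \<open>The components of the section \<open>N\<close> of the top exterior power of the dual normal tractor
  bundle, which are determined by the following conditions. The dual bundle is regarded as a
  subbundle of the dual tractor bundle by means of \<open>h\<close>: it is the annihilator of the orthogonal
  complement.\<close>

definition normal_tractor_form ::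
  "'n::{finite,linorder} metric_matrix \<Rightarrow> ('m::{finite,linorder}, 'n) parametrization \<Rightarrow> 'm coords
     \<Rightarrow> 'n tidx tensor \<Rightarrow> bool" where
  "normal_tractor_form G F y N \<longleftrightarrow>
     (let d = CARD('n) - CARD('m) in
      alternating d N \<and>
      (\<forall>V\<in>normal_tractors_perp G F y. \<forall>K. length K = d - 1 \<longrightarrow> (\<Sum>L\<in>UNIV. V $ L * N (L # K)) = 0) \<and>
      (\<Sum>K | length K = d. raise_all (tractor_metric G (F y)) N K * N K) = fact d \<and>
      (\<forall>vs. oriented_normal_frame G F y vs \<longrightarrow>
         tensor_eval N (map (normal_to_tractor G F y) vs) > 0))"

section \<open>Statements along a submanifold\<close>

text \<open>A property of sections over the submanifold \<open>S\<close>, expressed by components: it is required at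
  all points \<open>p\<close> of \<open>S\<close>, in the splitting by every metric \<open>\<Omega>\<^sup>2 g\<close> of the conformal class, and in
  all charts \<open>c\<close> of the ambient manifold and \<open>s\<close> of \<open>S\<close> around \<open>p\<close>.\<close>

definition along ::
  "'a topology \<Rightarrow> ('a, 'n::finite) chart set \<Rightarrow> 'a set \<Rightarrow> ('a, 'm::finite) chart set
     \<Rightarrow> (('a \<Rightarrow> real) \<Rightarrow> ('a, 'n) chart \<Rightarrow> ('a, 'm) chart \<Rightarrow> 'a \<Rightarrow> bool) \<Rightarrow> bool" where
  "along M A S AS Q \<longleftrightarrow>
     (\<forall>\<Omega> c s p. conformal_factor M A \<Omega> \<longrightarrow> c \<in> A \<longrightarrow> s \<in> AS \<longrightarrow> p \<in> S \<inter> fst c \<inter> fst s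
        \<longrightarrow> Q \<Omega> c s p)"

definition minimal_submanifold ::
  "('a, 'n::finite) chart set \<Rightarrow> ('a, 'n) metric \<Rightarrow> 'a set \<Rightarrow> ('a, 'm::finite) chart set \<Rightarrow> bool" where
  "minimal_submanifold A g S AS \<longleftrightarrow>
     (\<forall>c\<in>A. \<forall>s\<in>AS. \<forall>p\<in>S \<inter> fst c \<inter> fst s.
        mean_curvature (g c) (inclusion_in c s) (snd s p) = 0)"

end

theory Submission
  imports Defs
begin

text \<open>
  Let \<open>r\<close> be the value of \<open>\<Omega>\<close> at the point and \<open>H\<close> the mean curvature for \<open>g\<close>. The mean curvature for
  \<open>\<Omega>\<^sup>2 g\<close> is \<open>r\<^sup>-\<^sup>2\<close> times the difference of \<open>H\<close> and the normal part of the \<open>g\<close>-gradient of \<open>log \<Omega>\<close>, so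
  the gradient terms cancel when the scale tractor \<open>I\<close> is paired with the normal tractor of a normal
  vector \<open>u\<close>: the result is \<open>r g(H, u)\<close>. Hence the normal part of \<open>I\<close> is the mean curvature tractor
  \<open>w\<close>, the normal tractor of \<open>H / r\<close>, which vanishes exactly when \<open>H\<close> does; this gives conditions 1, 4
  and 5. For condition 2, contracting \<open>N\<close> with \<open>I\<close> amounts to contracting it with \<open>w\<close>; if \<open>H \<noteq> 0\<close>,
  then a multiple of \<open>H\<close> starts an oriented normal frame, on which \<open>N\<close> is positive, so the contraction
  is not 0. Finally, by Cramer's rule, the skew product of \<open>I\<close> with the Hodge star of \<open>N\<close> is a nonzero
  multiple of the Hodge star of the contraction, which reduces condition 3 to condition 2.
\<close>

section \<open>Alternating tensors on index lists\<close>

definition swap_entries :: "nat \<Rightarrow> nat \<Rightarrow> 'i list \<Rightarrow> 'i list" where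
  "swap_entries i j K = K[i := K ! j, j := K ! i]"

lemma length_permute_indices [simp]: "length (permute_indices \<pi> K) = length K"
  by (simp add: permute_indices_def)

lemma nth_permute_indices [simp]: "k < length K \<Longrightarrow> permute_indices \<pi> K ! k = K ! \<pi> k"
  by (simp add: permute_indices_def)

lemma permute_indices_id: "permute_indices id K = K"
  by (rule nth_equalityI) auto

text \<open>Acting on positions reverses the order of composition. The hypothesis keeps
  \<open>q k\<close> among the positions of \<open>K\<close>, where the entries of
  \<open>permute_indices p K\<close> are determined.\<close>

lemma permute_indices_compose:
  assumes "\<And>k. k < length K \<Longrightarrow> q k < length K"
  shows "permute_indices (p \<circ> q) K = permute_indices q (permute_indices p K)"
  by (rule nth_equalityI) (auto simp: assms)

lemma length_swap_entries [simp]: "length (swap_entries i j K) = length K"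
  by (simp add: swap_entries_def)

lemma permute_indices_transpose:
  assumes "i < length K" "j < length K"
  shows "permute_indices (Transposition.transpose i j) K = swap_entries i j K"
  using assms by (intro nth_equalityI) (auto simp: swap_entries_def nth_list_update Transposition.transpose_def)

lemma nth_swap_entries:
  assumes "i < length K" "j < length K" "k < length K"
  shows "swap_entries i j K ! k = K ! Transposition.transpose i j k"
  using assms by (auto simp: swap_entries_def nth_list_update Transposition.transpose_def)

lemma swap_entries_swap_entries [simp]:
  assumes "i < length K" "j < length K"
  shows "swap_entries i j (swap_entries i j K) = K"
proof (rule nth_equalityI)
  fix k assume "k < length (swap_entries i j (swap_entries i j K))"
  moreover from this have "Transposition.transpose i j k < length K"
    using assms by (simp add: Transposition.transpose_def)
  ultimately show "swap_entries i j (swap_entries i j K) ! k = K ! k"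
    using assms by (simp add: nth_swap_entries)
qed simp

lemma swap_entries_append:
  assumes "i < length K" "j < length K"
  shows "swap_entries (length A + i) (length A + j) (A @ K @ C) = A @ swap_entries i j K @ C"
  using assms by (simp add: swap_entries_def list_update_append nth_append)

text \<open>Every permutation of a finite set is a composite of transpositions. A subset
  \<open>S\<close> of positions is allowed because in \<open>skew_product\<close> only the positions
  after the first are known to be antisymmetric.\<close>

lemma permuted_by_swaps:
  fixes f :: "'i list \<Rightarrow> real"
  assumes swap: "\<And>K i j. length K = k \<Longrightarrow> i \<in> S \<Longrightarrow> j \<in> S \<Longrightarrow> i \<noteq> j \<Longrightarrow> f (swap_entries i j K) = - f K"
    and S: "S \<subseteq> {..<k}" and "\<pi> permutes S" and "length K = k"
  shows "f (permute_indices \<pi> K) = of_int (sign \<pi>) * f K"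
proof -
  have fin: "finite S"
    using S finite_subset by blast
  show ?thesis
    using \<open>\<pi> permutes S\<close> fin \<open>length K = k\<close>
  proof (induction arbitrary: K rule: permutes_induct)
    case id
    show ?case by (simp only: permute_indices_id sign_id)
  next
    case (swap a b p)
    have ab: "a < k" "b < k"
      using swap.hyps S by auto
    have "p n < k" if "n < k" for n
      using permutes_in_image[OF \<open>p permutes S\<close>, of n] permutes_not_in[OF \<open>p permutes S\<close>, of n] S that
      by (cases "n \<in> S") auto
    \<comment> \<open>On lists the outer transposition acts first, so the induction hypothesis is
      applied to the swapped list; hence the generalisation over \<open>K\<close>.\<close>
    then have *: "permute_indices (Transposition.transpose a b \<circ> p) K = permute_indices p (swap_entries a b K)"
      using swap.prems ab by (simp add: permute_indices_compose permute_indices_transpose)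
    have "permutation p" using \<open>p permutes S\<close> fin permutation_permutes by blast
    then have sign: "sign (Transposition.transpose a b \<circ> p) = - sign p"
      using \<open>a \<noteq> b\<close> by (simp add: sign_compose permutation_swap_id sign_swap_id)
    moreover have "f (permute_indices p (swap_entries a b K)) = of_int (sign p) * f (swap_entries a b K)"
      using swap.prems by (intro swap.IH) simp
    moreover have "f (swap_entries a b K) = - f K"
      using swap.prems swap.hyps by (intro assms(1)) auto
    ultimately show ?case
      unfolding * sign by simp
  qed
qed

lemma alternatingI:
  assumes "\<And>K i j. length K = k \<Longrightarrow> i < k \<Longrightarrow> j < k \<Longrightarrow> i \<noteq> j \<Longrightarrow> T (swap_entries i j K) = - T K"
  shows "alternating k T"
  unfolding alternating_def using permuted_by_swaps[of k "{..<k}" T] assms by auto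

lemma alternating_swap:
  assumes "alternating k T" "length K = k" "i < k" "j < k" "i \<noteq> j"
  shows "T (swap_entries i j K) = - T K"
proof -
  have "Transposition.transpose i j permutes {..<k}"
    using assms by (simp add: permutes_swap_id)
  then show ?thesis
    using assms unfolding alternating_def
    by (metis permute_indices_transpose sign_swap_id of_int_minus of_int_1 mult_minus1)
qed

lemma alternating_repeated:
  assumes "alternating k T" "length K = k" "i < k" "j < k" "i \<noteq> j" "K ! i = K ! j"
  shows "T K = 0"
proof -
  have "swap_entries i j K = K"
    using assms by (metis list_update_id swap_entries_def)
  then show ?thesis
    using alternating_swap[OF assms(1-5)] by simp
qed

lemma alternating_not_distinct:
  assumes "alternating k T" "length K = k" "\<not> distinct K"
  shows "T K = 0"
  using assms alternating_repeated by (metis distinct_conv_nth)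

lemma alternating_append:
  assumes "alternating (length A + k + length C) T"
  shows "alternating k (\<lambda>K. T (A @ K @ C))"
proof (rule alternatingI)
  fix K :: "'a list" and i j
  assume K: "length K = k" "i < k" "j < k" "i \<noteq> j"
  then show "T (A @ swap_entries i j K @ C) = - T (A @ K @ C)"
    using alternating_swap[OF assms, of "A @ K @ C" "length A + i" "length A + j"]
    by (simp add: swap_entries_append)
qed

lemma alternating_sum:
  fixes T :: "'b \<Rightarrow> 'i tensor"
  assumes "\<And>x. x \<in> X \<Longrightarrow> alternating k (T x)"
  shows "alternating k (\<lambda>K. \<Sum>x\<in>X. c x * T x K)"
proof (rule alternatingI)
  fix K :: "'i list" and i j
  assume K: "length K = k" "i < k" "j < k" "i \<noteq> j"
  show "(\<Sum>x\<in>X. c x * T x (swap_entries i j K)) = - (\<Sum>x\<in>X. c x * T x K)"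
    by (simp add: alternating_swap[OF assms K] sum_negf cong: sum.cong)
qed

section \<open>Exchange of indices and skew products\<close>

lemma update_eq_swap_entries_update:
  assumes "a < length Y" "b < length Y" "a \<noteq> b" "Y ! a = Y ! b"
  shows "Y[b := x] = swap_entries a b (Y[a := x])"
  using assms by (intro nth_equalityI) (auto simp: swap_entries_def nth_list_update)

text \<open>Cramer's rule: antisymmetrisation over one index more than the dimension gives zero.\<close>

lemma alternating_exchange:
  fixes T :: "'i::finite tensor"
  assumes T: "alternating CARD('i) T" and Y: "length Y = CARD('i)"
  shows "v x * T Y = (\<Sum>i<CARD('i). v (Y ! i) * T (Y[i := x]))"
proof (cases "distinct Y")
  case True
  then have "set Y = UNIV"
    using Y by (metis card_subset_eq distinct_card finite subset_UNIV)
  then obtain a where a: "a < CARD('i)" "Y ! a = x"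
    using Y by (metis UNIV_I in_set_conv_nth)
  \<comment> \<open>\<open>x\<close> already stands at position \<open>a\<close>, so writing it at
    another position repeats it.\<close>
  have "T (Y[i := x]) = 0" if "i < CARD('i)" "i \<noteq> a" for i
    using that a Y by (intro alternating_repeated[OF T, of _ i a]) auto
  then have "(\<Sum>i<CARD('i). v (Y ! i) * T (Y[i := x])) = (\<Sum>i<CARD('i). if i = a then v (Y ! i) * T (Y[i := x]) else 0)"
    by (intro sum.cong) auto
  also have "\<dots> = v x * T Y"
    using a by auto
  finally show ?thesis by simp
next
  case False
  then obtain a b where ab: "a < CARD('i)" "b < CARD('i)" "a \<noteq> b" "Y ! a = Y ! b"
    using Y by (auto simp: distinct_conv_nth)
  \<comment> \<open>An update away from \<open>a\<close> and \<open>b\<close> leaves the repetition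
    in place.\<close>
  have "T (Y[i := x]) = 0" if "i < CARD('i)" "i \<notin> {a, b}" for i
    using that ab Y by (intro alternating_repeated[OF T, of _ a b]) auto
  then have "(\<Sum>i<CARD('i). v (Y ! i) * T (Y[i := x])) = (\<Sum>i\<in>{a, b}. v (Y ! i) * T (Y[i := x]))"
    using ab by (intro sum.mono_neutral_right) auto
  \<comment> \<open>The coefficients agree because \<open>Y ! a = Y ! b\<close>, and the two updated
    lists differ by a swap, so the terms cancel.\<close>
  also have "\<dots> = 0"
    using ab Y alternating_swap[OF T, of "Y[a := x]" a b] update_eq_swap_entries_update[of a Y b x]
    by (simp add: sum.insert)
  finally show ?thesis
    using alternating_not_distinct[OF T Y False] by simp
qed

text \<open>Permutations of the \<open>Suc r\<close> positions are grouped by the entry that reaches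
  \<open>v\<close>. As \<open>B\<close> is alternating, the \<open>fact r\<close> members of a group
  contribute equally, which accounts for the factor \<open>Suc r\<close>. The entry
  \<open>K ! j\<close> reaches \<open>v\<close> by an exchange with \<open>x\<close>, hence the
  minus sign.\<close>

lemma skew_product:
  fixes B :: "'i tensor"
  assumes B: "alternating r B" and K: "length K = r"
  shows "real (Suc r) * skew (Suc r) (\<lambda>K. v (hd K) * B (tl K)) (x # K) =
    v x * B K - (\<Sum>j<r. v (K ! j) * B (K[j := x]))"
proof -
  let ?T = "\<lambda>K. v (hd K) * B (tl K)"
  let ?S = "{1..<Suc r}"
  have S: "{..<Suc r} = insert 0 ?S" by auto
  define X where "X b = swap_entries 0 b (x # K)" for b
  have tl_swap: "B (tl (swap_entries i j L)) = - B (tl L)"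
    if L: "length L = Suc r" "i \<in> ?S" "j \<in> ?S" "i \<noteq> j" for i j L
  proof -
    obtain l L' where L': "L = l # L'" using L by (cases L) auto
    have "swap_entries i j L = l # swap_entries (i - 1) (j - 1) L'"
      using L L' swap_entries_append[of "i - 1" L' "j - 1" "[l]" "[]"] by auto
    then show ?thesis
      using alternating_swap[OF B, of L' "i - 1" "j - 1"] L L' by auto
  qed
  \<comment> \<open>A permutation of all positions is \<open>transpose 0 b\<close> composed with a
    permutation \<open>q\<close> of the positions after the first. The sign of \<open>q\<close>
    occurs twice, in the skew sum and from \<open>B\<close>, and cancels.\<close>
  have summand: "of_int (sign (Transposition.transpose 0 b \<circ> q)) * ?T (permute_indices (Transposition.transpose 0 b \<circ> q) (x # K))
      = (if b = 0 then 1 else - 1) * (v (hd (X b)) * B (tl (X b)))"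
    if b: "b \<in> insert 0 ?S" and q: "q permutes ?S" for b q
  proof -
    have len: "length (X b) = Suc r" using K by (simp add: X_def)
    have qin: "q n < Suc r" if "n < Suc r" for n
      using permutes_in_image[OF q, of n] permutes_not_in[OF q, of n] that by (cases "n \<in> ?S") auto
    then have *: "permute_indices (Transposition.transpose 0 b \<circ> q) (x # K) = permute_indices q (X b)"
      using K b permute_indices_compose[of "x # K" q] permute_indices_transpose[of 0 "x # K" b]
      unfolding X_def by auto
    have "B (tl (permute_indices q (X b))) = of_int (sign q) * B (tl (X b))"
      by (rule permuted_by_swaps[of "Suc r" ?S "\<lambda>K. B (tl K)" q "X b", OF tl_swap _ q len]) auto
    moreover have "hd (permute_indices q (X b)) = hd (X b)"
    proof -
      have "q 0 = 0" using q by (simp add: permutes_def)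
      then show ?thesis
        using len by (metis hd_conv_nth length_permute_indices length_0_conv nat.distinct(1) nth_permute_indices zero_less_Suc)
    qed
    moreover have "permutation q" using q permutation_permutes by blast
    moreover have "sign q * sign q = 1" by (simp add: sign_def)
    then have "real_of_int (sign q) * (real_of_int (sign q) * y) = y" for y
      by (metis mult.assoc mult.left_neutral of_int_1 of_int_mult)
    ultimately show ?thesis
      by (auto simp: * sign_compose permutation_swap_id sign_swap_id)
  qed
  have "(\<Sum>\<pi> | \<pi> permutes {..<Suc r}. of_int (sign \<pi>) * ?T (permute_indices \<pi> (x # K)))
      = (\<Sum>b\<in>insert 0 ?S. \<Sum>q | q permutes ?S. of_int (sign (Transposition.transpose 0 b \<circ> q)) * ?T (permute_indices (Transposition.transpose 0 b \<circ> q) (x # K)))"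
    unfolding S by (subst sum_over_permutations_insert) auto
  also have "\<dots> = (\<Sum>b\<in>insert 0 ?S. \<Sum>q | q permutes ?S. (if b = 0 then 1 else - 1) * (v (hd (X b)) * B (tl (X b))))"
    using summand by (intro sum.cong) auto
  also have "\<dots> = fact r * (\<Sum>b\<in>insert 0 ?S. (if b = 0 then 1 else - 1) * (v (hd (X b)) * B (tl (X b))))"
    using card_permutations[of ?S r] unfolding sum_constant sum_distrib_left by simp
  also have "(\<Sum>b\<in>insert 0 ?S. (if b = 0 then 1 else - 1) * (v (hd (X b)) * B (tl (X b))))
      = v x * B K - (\<Sum>b\<in>?S. v (hd (X b)) * B (tl (X b)))"
  proof -
    have "(\<Sum>b\<in>?S. (if b = 0 then 1 else - 1) * (v (hd (X b)) * B (tl (X b)))) =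
        (\<Sum>b\<in>?S. - (v (hd (X b)) * B (tl (X b))))"
      by (rule sum.cong) auto
    moreover have "X 0 = x # K" by (simp add: X_def swap_entries_def)
    ultimately show ?thesis by (subst sum.insert) (auto simp: sum_negf)
  qed
  \<comment> \<open>The swap of positions 0 and \<open>Suc j\<close> brings \<open>K ! j\<close> to
    the head and leaves \<open>K[j := x]\<close> as the tail.\<close>
  also have "(\<Sum>b\<in>?S. v (hd (X b)) * B (tl (X b))) = (\<Sum>j<r. v (K ! j) * B (K[j := x]))"
    by (rule sum.reindex_bij_witness[of _ Suc "\<lambda>i. i - 1"]) (auto simp: X_def swap_entries_def split: nat.split)
  finally show ?thesis
    by (simp add: skew_def field_simps del: of_nat_Suc)
qed

section \<open>The Hodge star\<close>

lemma matrix_inv_works: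
  fixes A :: "real^'k^'k"
  assumes "invertible A"
  shows "A ** matrix_inv A = mat 1" "matrix_inv A ** A = mat 1"
  using someI_ex[OF assms[unfolded invertible_def]] unfolding matrix_inv_def by auto

lemma matrix_inv_unique:
  fixes A :: "real^'k^'k"
  assumes "A ** B = mat 1"
  shows "matrix_inv A = B"
proof -
  have inv: "invertible A"
    using assms invertible_right_inverse by blast
  have "matrix_inv A = matrix_inv A ** (A ** B)"
    using assms by simp
  also have "\<dots> = B"
    using matrix_inv_works(2)[OF inv] by (simp add: matrix_mul_assoc)
  finally show ?thesis .
qed

section \<open>Numbering of coordinate and tractor indices\<close>

lemma index_pos_bij: "bij_betw (index_pos :: 'n::{finite,linorder} \<Rightarrow> nat) UNIV {..<CARD('n)}"
proof -
  have less: "index_pos i < index_pos j" if "i < j" for i j :: 'n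
    unfolding index_pos_def using that by (intro psubset_card_mono) auto
  have inj: "inj (index_pos :: 'n \<Rightarrow> nat)"
    by (metis injI less linorder_neqE order_less_irrefl)
  have "index_pos i < CARD('n)" for i :: 'n
    unfolding index_pos_def by (intro psubset_card_mono) auto
  then have "range (index_pos :: 'n \<Rightarrow> nat) = {..<CARD('n)}"
    using inj by (intro card_subset_eq) (auto simp: card_image)
  then show ?thesis
    using inj by (simp add: bij_betw_def)
qed

lemma index_pos_surj:
  fixes k :: nat
  assumes "k < CARD('n)"
  obtains i :: "'n::{finite,linorder}" where "index_pos i = k"
proof -
  have "k \<in> range (index_pos :: 'n \<Rightarrow> nat)"
    using assms bij_betw_imp_surj_on[OF index_pos_bij[where 'n='n]] by simp
  then show ?thesis using that by blast
qed

lemma index_pos_eq_iff: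
  fixes i j :: "'n::{finite,linorder}"
  shows "index_pos i = index_pos j \<longleftrightarrow> i = j"
  using bij_betw_imp_inj_on[OF index_pos_bij[where 'n='n]] by (simp add: inj_eq)

lemma tidx_UNIV: "(UNIV :: 'n::finite tidx set) = insert Tsig (insert Trho (range Tmu))"
  by (auto, metis tidx.exhaust rangeI)

lemma card_tidx: "CARD('n::finite tidx) = CARD('n) + 2"
proof -
  have "inj (Tmu :: 'n \<Rightarrow> 'n tidx)" by (simp add: inj_def)
  moreover have "(Tsig :: 'n tidx) \<notin> range Tmu" "(Trho :: 'n tidx) \<notin> range Tmu" by auto
  ultimately show ?thesis by (simp add: tidx_UNIV card_image)
qed

lemma sum_tidx:
  "(\<Sum>K\<in>UNIV. f (K :: 'n::finite tidx)) = f Tsig + f Trho + (\<Sum>a\<in>UNIV. f (Tmu a) :: 'b::comm_monoid_add)"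
proof -
  have "inj (Tmu :: 'n \<Rightarrow> 'n tidx)" by (simp add: inj_def)
  moreover have "(Tsig :: 'n tidx) \<notin> range Tmu" "(Trho :: 'n tidx) \<notin> range Tmu" by auto
  ultimately show ?thesis by (simp add: tidx_UNIV sum.reindex add.assoc)
qed

lemma tidx_pos_bij: "bij_betw (tidx_pos :: 'n::{finite,linorder} tidx \<Rightarrow> nat) UNIV {..<CARD('n tidx)}"
proof -
  have pos: "index_pos i < CARD('n)" for i :: 'n
    using index_pos_bij bij_betw_apply by fastforce
  have inj_pos: "index_pos i = index_pos j \<Longrightarrow> i = j" for i j :: 'n
    using index_pos_bij by (metis UNIV_I bij_betw_inv_into_left)
  have "inj (tidx_pos :: 'n tidx \<Rightarrow> nat)"
  proof (rule injI)
    fix x y :: "'n tidx" assume "tidx_pos x = tidx_pos y"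
    then show "x = y"
      using pos inj_pos by (cases x; cases y) (auto dest: less_not_refl2, (metis less_irrefl)+)
  qed
  moreover have "tidx_pos x < CARD('n tidx)" for x :: "'n tidx"
  proof (cases x)
    case (Tmu i)
    then show ?thesis using pos[of i] by (simp add: card_tidx)
  qed (simp_all add: card_tidx)
  ultimately show ?thesis
    unfolding bij_betw_def by (intro conjI card_subset_eq) (auto simp: card_image)
qed

lemma tidx_pos_less: "tidx_pos (x :: 'n::{finite,linorder} tidx) < CARD('n tidx)"
  using tidx_pos_bij bij_betw_apply by fastforce

section \<open>The Levi-Civita symbol and the raised volume form\<close>

lemma levi_civita_alternating:
  "alternating CARD('n tidx) (levi_civita :: 'n::{finite,linorder} tidx tensor)"
proof (rule alternatingI)
  fix K :: "'n tidx list" and i j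
  assume K: "length K = CARD('n tidx)" "i < CARD('n tidx)" "j < CARD('n tidx)" "i \<noteq> j"
  then obtain a b :: "'n tidx" where ab: "i = tidx_pos a" "j = tidx_pos b"
    using tidx_pos_bij[where 'n='n] by (metis bij_betw_imp_surj_on imageE lessThan_iff)
  \<comment> \<open>Through the numbering, a swap of positions becomes an exchange of two rows of
    the determinant.\<close>
  have pos: "Transposition.transpose i j (tidx_pos x) = tidx_pos (Transposition.transpose a b x)" for x :: "'n tidx"
    using tidx_pos_bij[where 'n='n] unfolding ab
    by (simp add: Transposition.transpose_def bij_betw_def inj_eq)
  have "levi_civita (swap_entries i j K) =
      det (\<chi> r. (\<chi> r c. if K ! tidx_pos r = c then 1 else (0::real)) $ Transposition.transpose a b r)"
    using K by (simp add: levi_civita_def nth_swap_entries tidx_pos_less pos)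
  also have "\<dots> = - levi_civita K"
    using K ab by (subst det_permute_rows) (auto simp: permutes_swap_id sign_swap_id levi_civita_def)
  finally show "levi_civita (swap_entries i j K) = - levi_civita K" .
qed

text \<open>A distinct list of full length takes every value, so the matrix is a permutation matrix.
  Its kernel is trivial because each coordinate of \<open>x\<close> occurs as an entry of the
  product.\<close>

lemma levi_civita_nonzero:
  fixes K :: "'n::{finite,linorder} tidx list"
  assumes "length K = CARD('n tidx)" "distinct K"
  shows "levi_civita K \<noteq> 0"
proof -
  let ?A = "(\<chi> i j. if K ! tidx_pos i = j then 1 else 0) :: 'n tractor_matrix"
  have "set K = UNIV"
    using assms by (metis card_subset_eq distinct_card finite subset_UNIV)
  have "x = 0" if "?A *v x = 0" for x :: "real^'n tidx"
  proof -
    have "x $ k = 0" for k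
    proof -
      obtain r where r: "r < CARD('n tidx)" "K ! r = k"
        using \<open>set K = UNIV\<close> assms by (metis UNIV_I in_set_conv_nth)
      then obtain a :: "'n tidx" where "r = tidx_pos a"
        using tidx_pos_bij[where 'n='n] by (metis bij_betw_imp_surj_on imageE lessThan_iff)
      then have "(?A *v x) $ a = x $ k"
        using r by (simp add: matrix_vector_mult_def if_distrib[of "\<lambda>c. c * _"] cong: if_cong)
      then show ?thesis unfolding that by (simp only: zero_index)
    qed
    then show ?thesis by (simp add: vec_eq_iff)
  qed
  then have "invertible ?A"
    by (meson invertible_left_inverse matrix_left_invertible_ker)
  then show ?thesis
    by (simp add: levi_civita_def invertible_det_nz)
qed

text \<open>The determinant is multilinear in the rows: with \<open>P\<close> the 0-1 matrix of
  \<open>K\<close>, expanding every row of \<open>P ** matrix_inv h\<close> in the standard basis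
  produces the sum that raises all indices of the Levi-Civita symbol.\<close>

lemma raise_tractor_volume:
  fixes h :: "'n::{finite,linorder} tractor_matrix"
  assumes K: "length K = CARD('n tidx)"
  shows "raise_all h (tractor_volume h) K = sqrt \<bar>det h\<bar> * det (matrix_inv h) * levi_civita K"
proof -
  let ?H = "matrix_inv h"
  let ?p = "\<lambda>x. tidx_pos (x :: 'n tidx)"
  let ?P = "\<chi> i j. if K ! ?p i = j then 1 else (0::real)"
  define inv where "inv = inv_into UNIV ?p"
  have inv: "inv (?p x) = x" for x
    unfolding inv_def by (rule bij_betw_inv_into_left[OF tidx_pos_bij UNIV_I])
  have p_inv: "?p (inv k) = k" if "k < CARD('n tidx)" for k
    unfolding inv_def using that by (intro bij_betw_inv_into_right[OF tidx_pos_bij]) simp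
  have prod_pos: "(\<Prod>k<CARD('n tidx). f k) = (\<Prod>x\<in>UNIV. f (?p x))" for f :: "nat \<Rightarrow> real"
    by (rule prod.reindex_bij_betw[OF tidx_pos_bij, symmetric])
  \<comment> \<open>A list \<open>L\<close> is read as the function that assigns to a row index the
    entry at its position. Each summand is then a determinant of basis vectors scaled by entries of
    \<open>?H\<close>.\<close>
  have "(\<Sum>L | length L = CARD('n tidx). (\<Prod>k<CARD('n tidx). ?H $ (K ! k) $ (L ! k)) * levi_civita L)
      = (\<Sum>f | \<forall>i. f i \<in> UNIV. det (\<chi> i. ?H $ (K ! ?p i) $ f i *s axis (f i) 1))"
  proof (rule sum.reindex_bij_witness[of _ "\<lambda>f. map (f \<circ> inv) [0..<CARD('n tidx)]" "\<lambda>L x. L ! ?p x"])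
    fix L :: "'n tidx list" assume "L \<in> {L. length L = CARD('n tidx)}"
    then show "map ((\<lambda>x. L ! ?p x) \<circ> inv) [0..<CARD('n tidx)] = L"
      by (intro nth_equalityI) (auto simp: p_inv)
    have "(\<chi> i j. if L ! ?p i = j then 1 else (0::real)) = (\<chi> i. axis (L ! ?p i) 1)"
      by (auto simp: vec_eq_iff axis_def)
    then have "levi_civita L = det (\<chi> i. axis (L ! ?p i) (1::real))"
      unfolding levi_civita_def by simp
    then show "det (\<chi> i. ?H $ (K ! ?p i) $ (L ! ?p i) *s axis (L ! ?p i) 1) =
        (\<Prod>k<CARD('n tidx). ?H $ (K ! k) $ (L ! k)) * levi_civita L"
      unfolding prod_pos by (simp only: det_rows_mul)
  next
    fix f :: "'n tidx \<Rightarrow> 'n tidx"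
    show "(\<lambda>x. map (f \<circ> inv) [0..<CARD('n tidx)] ! ?p x) = f"
      by (simp add: tidx_pos_less inv)
  qed auto
  also have "\<dots> = det (\<chi> i. \<Sum>j\<in>UNIV. ?H $ (K ! ?p i) $ j *s axis j 1)"
    by (rule det_linear_rows_sum[symmetric]) simp
  also have "(\<chi> i. \<Sum>j\<in>UNIV. ?H $ (K ! ?p i) $ j *s axis j 1) = ?P ** ?H"
    by (simp add: basis_expansion) (simp add: vec_eq_iff matrix_matrix_mult_def if_distrib[of "\<lambda>c. c * _"] cong: if_cong)
  also have "det \<dots> = levi_civita K * det ?H"
    by (simp add: det_mul levi_civita_def)
  finally have "(\<Sum>L | length L = CARD('n tidx). (\<Prod>k<CARD('n tidx). ?H $ (K ! k) $ (L ! k)) * levi_civita L)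
      = levi_civita K * det ?H" .
  then show ?thesis
    unfolding raise_all_def tractor_volume_def K mult.left_commute[of _ "sqrt _"] sum_distrib_left[symmetric]
    by (simp only: mult_ac)
qed

section \<open>Contractions and dual forms\<close>

lemma sum_lessThan_add:
  "(\<Sum>i<a + b. f i) = (\<Sum>i<a. f i) + (\<Sum>j<b. f (a + j :: nat) :: 'b::comm_monoid_add)"
  by (induction b) (auto simp: add.assoc)

lemma sum_lists_Suc:
  fixes f :: "'i::finite list \<Rightarrow> real"
  shows "(\<Sum>L | length L = Suc k. f L) = (\<Sum>l\<in>UNIV. \<Sum>L | length L = k. f (l # L))"
proof -
  have "(\<Sum>L | length L = Suc k. f L) = (\<Sum>(l, L)\<in>UNIV \<times> {L. length L = k}. f (l # L))"
    by (rule sum.reindex_bij_witness[of _ "\<lambda>(l, L). l # L" "\<lambda>L. (hd L, tl L)"]) (auto simp: length_Suc_conv)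
  then show ?thesis by (simp add: sum.cartesian_product)
qed

lemma finite_lists_length: "finite {L :: 'i::finite list. length L = k}"
  using finite_lists_length_eq[of "UNIV :: 'i set" k] by simp

text \<open>The interior product with the vector \<open>v\<close>, taken in the first slot; the sum
  in the second condition has this form.\<close>

definition contract :: "('i::finite \<Rightarrow> real) \<Rightarrow> 'i tensor \<Rightarrow> 'i tensor" where
  "contract v T K = (\<Sum>l\<in>UNIV. v l * T (l # K))"

lemma alternating_contract:
  assumes "alternating (Suc k) T"
  shows "alternating k (contract v T)"
proof -
  have "alternating k (\<lambda>K. T ([l] @ K @ []))" for l
    using assms by (intro alternating_append) simp
  then have "alternating k (\<lambda>K. \<Sum>l\<in>UNIV. v l * T ([l] @ K @ []))"
    by (rule alternating_sum)
  then show ?thesis by (simp add: contract_def[abs_def])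
qed

text \<open>Up to constants this is the classical identity that the wedge product of
  \<open>v\<close> with the dual of \<open>T\<close> is the dual of the interior product. In the
  expansion by \<open>skew_product\<close>, the terms that alter \<open>K\<close> are part of
  Cramer's rule for \<open>L @ K\<close>; those that alter \<open>L\<close> remain, and all
  \<open>Suc k\<close> positions of \<open>L\<close> contribute equally.\<close>

lemma skew_product_dual:
  fixes T E :: "'i::finite tensor"
  assumes T: "alternating (Suc k) T" and E: "alternating CARD('i) E"
    and card: "Suc k + r = CARD('i)" and K: "length K = r"
  shows "real (Suc r) * skew (Suc r)
        (\<lambda>K. v (hd K) * (\<Sum>L | length L = Suc k. T L * E (L @ tl K))) (x # K) =
      real (Suc k) * (\<Sum>L | length L = k. contract v T L * E (x # L @ K))"
proof -
  define B where "B K = (\<Sum>L | length L = Suc k. T L * E (L @ K))" for K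
  have "alternating r (\<lambda>K. E (L @ K @ []))" if "length L = Suc k" for L
    using E card that by (intro alternating_append) simp
  then have B: "alternating r B"
    unfolding B_def[abs_def] by (intro alternating_sum) simp
  have exchange: "v x * E (L @ K) - (\<Sum>j<r. v (K ! j) * E (L @ K[j := x]))
      = (\<Sum>i<Suc k. v (L ! i) * E (L[i := x] @ K))" if L: "length L = Suc k" for L
  proof -
    have "v x * E (L @ K) = (\<Sum>i<Suc k + r. v ((L @ K) ! i) * E ((L @ K)[i := x]))"
      using alternating_exchange[OF E, of "L @ K" v x] L K card by simp
    also have "\<dots> = (\<Sum>i<Suc k. v ((L @ K) ! i) * E ((L @ K)[i := x])) +
        (\<Sum>j<r. v ((L @ K) ! (Suc k + j)) * E ((L @ K)[Suc k + j := x]))"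
      by (rule sum_lessThan_add)
    also have "\<dots> = (\<Sum>i<Suc k. v (L ! i) * E (L[i := x] @ K)) + (\<Sum>j<r. v (K ! j) * E (L @ K[j := x]))"
      using L by (intro arg_cong2[of _ _ _ _ "(+)"] sum.cong) (auto simp: nth_append list_update_append)
    finally show ?thesis by simp
  qed
  \<comment> \<open>Swapping positions 0 and \<open>i\<close> of the summation list changes the sign
    of both \<open>T\<close> and \<open>E\<close>, so every position contributes as much as the
    first.\<close>
  have first: "(\<Sum>L | length L = Suc k. T L * (v (L ! i) * E (L[i := x] @ K)))
      = (\<Sum>L | length L = Suc k. T L * (v (L ! 0) * E (L[0 := x] @ K)))" if i: "i < Suc k" for i
  proof (cases "i = 0")
    case False
    show ?thesis
    proof (rule sum.reindex_bij_witness[of _ "swap_entries 0 i" "swap_entries 0 i"])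
      fix L :: "'i list" assume "L \<in> {L. length L = Suc k}"
      then have L: "length L = Suc k" by simp
      have "swap_entries 0 i (L[i := x]) = (swap_entries 0 i L)[0 := x]"
        using L i by (intro nth_equalityI) (auto simp: swap_entries_def nth_list_update)
      then have "E ((swap_entries 0 i L)[0 := x] @ K) = - E (L[i := x] @ K)"
        using alternating_swap[OF E, of "L[i := x] @ K" 0 i] swap_entries_append[of 0 "L[i := x]" i "[]" K]
          L i K card False by simp
      moreover have "T (swap_entries 0 i L) = - T L"
        using alternating_swap[OF T L, of 0 i] i False by simp
      moreover have "swap_entries 0 i L ! 0 = L ! i"
        using L i by (simp add: swap_entries_def False)
      ultimately show "T (swap_entries 0 i L) * (v (swap_entries 0 i L ! 0) * E ((swap_entries 0 i L)[0 := x] @ K))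
          = T L * (v (L ! i) * E (L[i := x] @ K))" by simp
    qed (use i in auto)
  qed simp
  have "real (Suc r) * skew (Suc r) (\<lambda>K. v (hd K) * B (tl K)) (x # K) =
      v x * B K - (\<Sum>j<r. v (K ! j) * B (K[j := x]))"
    by (rule skew_product[OF B K])
  also have "\<dots> = (\<Sum>L | length L = Suc k. T L * (v x * E (L @ K) - (\<Sum>j<r. v (K ! j) * E (L @ K[j := x]))))"
  proof -
    have "(\<Sum>j<r. v (K ! j) * B (K[j := x])) =
        (\<Sum>j<r. \<Sum>L | length L = Suc k. T L * (v (K ! j) * E (L @ K[j := x])))"
      unfolding B_def sum_distrib_left by (simp only: mult.left_commute)
    also have "\<dots> = (\<Sum>L | length L = Suc k. T L * (\<Sum>j<r. v (K ! j) * E (L @ K[j := x])))"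
      unfolding sum_distrib_left by (rule sum.swap)
    finally show ?thesis
      unfolding B_def sum_distrib_left right_diff_distrib sum_subtractf
      by (simp only: mult.left_commute)
  qed
  also have "\<dots> = (\<Sum>L | length L = Suc k. T L * (\<Sum>i<Suc k. v (L ! i) * E (L[i := x] @ K)))"
    using exchange by (intro sum.cong) auto
  also have "\<dots> = (\<Sum>i<Suc k. \<Sum>L | length L = Suc k. T L * (v (L ! i) * E (L[i := x] @ K)))"
    unfolding sum_distrib_left by (rule sum.swap)
  also have "\<dots> = (\<Sum>i<Suc k. \<Sum>L | length L = Suc k. T L * (v (L ! 0) * E (L[0 := x] @ K)))"
    by (intro sum.cong refl first) simp
  also have "\<dots> = real (Suc k) * (\<Sum>L | length L = Suc k. T L * (v (L ! 0) * E (L[0 := x] @ K)))"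
    unfolding sum_constant by simp
  \<comment> \<open>The first entry of \<open>L\<close> is split off: it is contracted between
    \<open>v\<close> and \<open>T\<close>, while \<open>x\<close> takes its place in
    \<open>E\<close>.\<close>
  also have "(\<Sum>L | length L = Suc k. T L * (v (L ! 0) * E (L[0 := x] @ K)))
      = (\<Sum>L | length L = k. contract v T L * E (x # L @ K))"
  proof -
    have "(\<Sum>L | length L = Suc k. T L * (v (L ! 0) * E (L[0 := x] @ K)))
        = (\<Sum>l\<in>UNIV. \<Sum>L | length L = k. v l * T (l # L) * E (x # L @ K))"
      unfolding sum_lists_Suc by (simp add: mult_ac)
    also have "\<dots> = (\<Sum>L | length L = k. \<Sum>l\<in>UNIV. v l * T (l # L) * E (x # L @ K))"
      by (rule sum.swap)
    finally show ?thesis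
      unfolding contract_def sum_distrib_right .
  qed
  finally show ?thesis
    by (simp add: B_def)
qed

text \<open>Duality is injective: a component \<open>T L0\<close> with distinct entries is isolated
  by completing \<open>L0\<close> with the indices that it omits.\<close>

lemma dual_eq_0_iff:
  fixes T E :: "'i::finite tensor"
  assumes T: "alternating k T" and E: "alternating CARD('i) E"
    and E0: "\<And>K. length K = CARD('i) \<Longrightarrow> distinct K \<Longrightarrow> E K \<noteq> 0"
    and card: "Suc (k + r) = CARD('i)"
  shows "(\<forall>x K. length K = r \<longrightarrow> (\<Sum>L | length L = k. T L * E (x # L @ K)) = 0) \<longleftrightarrow>
    (\<forall>L. length L = k \<longrightarrow> T L = 0)"
proof
  assume zero: "\<forall>x K. length K = r \<longrightarrow> (\<Sum>L | length L = k. T L * E (x # L @ K)) = 0"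
  show "\<forall>L. length L = k \<longrightarrow> T L = 0"
  proof (intro allI impI)
    fix L0 :: "'i list" assume L0: "length L0 = k"
    show "T L0 = 0"
    proof (cases "distinct L0")
      case True
      \<comment> \<open>\<open>Z\<close> lists the complement of \<open>L0\<close>. It has
        \<open>Suc r\<close> entries, the first of which serves as \<open>x\<close> and the others
        as \<open>K\<close>.\<close>
      obtain Z where Z: "set Z = - set L0" "distinct Z"
        by (meson finite finite_distinct_list)
      have lenZ: "length Z = Suc r"
      proof -
        have "card (- set L0) = CARD('i) - k"
          using L0 True by (simp add: Compl_eq_Diff_UNIV card_Diff_subset distinct_card)
        then show ?thesis
          using distinct_card[OF Z(2)] Z(1) card by simp
      qed
      then obtain x K where xK: "Z = x # K" "length K = r"
        by (auto simp: length_Suc_conv)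
      have E1: "alternating k (\<lambda>L. E ([x] @ L @ K))"
        using E card xK by (intro alternating_append) simp
      \<comment> \<open>Rearranging \<open>L0\<close> changes \<open>T\<close> and \<open>E\<close>
        by the same sign, so their product stays the same.\<close>
      have const: "T L * E (x # L @ K) = T L0 * E (x # L0 @ K)"
        if L: "length L = k" "distinct L" "set L = set L0" for L
      proof -
        have "mset L = mset L0"
          using L True by (simp add: set_eq_iff_mset_eq_distinct)
        then obtain p where p: "p permutes {..<length L0}" "permute_list p L0 = L"
          by (rule mset_eq_permutation)
        then have "L = permute_indices p L0"
          by (simp add: permute_list_def permute_indices_def)
        then show ?thesis
          using T E1 p L0 unfolding alternating_def by (cases "evenperm p") (auto simp: sign_def)
      qed
      \<comment> \<open>Either \<open>L\<close> repeats an entry and \<open>T\<close> vanishes, or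
        \<open>L\<close> contains an entry of \<open>Z\<close>, which then occurs twice in the
        argument of \<open>E\<close>.\<close>
      have vanish: "T L * E (x # L @ K) = 0"
        if L: "length L = k" "\<not> (distinct L \<and> set L = set L0)" for L
      proof (cases "distinct L")
        case True
        have "\<not> set L \<subseteq> set L0"
          using L True \<open>distinct L0\<close> L0 by (metis card_subset_eq distinct_card finite_set)
        then have "\<not> distinct (x # L @ K)"
          using Z xK by auto
        then show ?thesis
          using alternating_not_distinct[OF E] L xK card by simp
      qed (use alternating_not_distinct[OF T] L in simp)
      have "0 = (\<Sum>L | length L = k. T L * E (x # L @ K))"
        using zero xK by simp
      also have "\<dots> = (\<Sum>L | length L = k \<and> distinct L \<and> set L = set L0. T L * E (x # L @ K))"
        using vanish finite_lists_length by (intro sum.mono_neutral_right) auto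
      also have "\<dots> = real (card {L. length L = k \<and> distinct L \<and> set L = set L0}) * (T L0 * E (x # L0 @ K))"
        using const by simp
      finally have "card {L. length L = k \<and> distinct L \<and> set L = set L0} = 0 \<or> T L0 * E (x # L0 @ K) = 0"
        by simp
      \<comment> \<open>\<open>L0\<close> itself is counted, so the common value of the summands
        must vanish.\<close>
      moreover have "card {L. length L = k \<and> distinct L \<and> set L = set L0} \<noteq> 0"
      proof -
        have "finite {L. length L = k \<and> distinct L \<and> set L = set L0}"
          by (rule finite_subset[OF _ finite_lists_length[of k]]) auto
        moreover have "L0 \<in> {L. length L = k \<and> distinct L \<and> set L = set L0}"
          using L0 True by simp
        ultimately show ?thesis
          unfolding card_eq_0_iff by blast
      qed
      ultimately have "T L0 * E (x # L0 @ K) = 0"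
        by (simp only: simp_thms)
      moreover have "E (x # L0 @ K) \<noteq> 0"
        using Z xK L0 True card by (intro E0) auto
      ultimately show ?thesis by simp
    qed (use alternating_not_distinct[OF T] L0 in simp)
  qed
qed simp

text \<open>\<open>skew\<close> evaluates its argument only at rearrangements of \<open>K\<close>,
  so a comparison at lists of that length suffices; the formula for the Hodge star is available only
  at one length.\<close>

lemma skew_scale:
  assumes "\<And>L. length L = length K \<Longrightarrow> T L = c * T' L"
  shows "skew k T K = c * skew k T' K"
proof -
  have "T (permute_indices \<pi> K) = c * T' (permute_indices \<pi> K)" for \<pi>
    by (rule assms) simp
  then show ?thesis
    unfolding skew_def sum_distrib_left by (simp only: mult.left_commute)
qed

text \<open>The Hodge star is a nonzero multiple of the dual formed with the Levi-Civita symbol. So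
  \<open>skew_product_dual\<close> turns the skew product with \<open>I\<close> into a dual of the
  contraction, and \<open>dual_eq_0_iff\<close> removes the dual.\<close>

lemma skew_hodge_star_eq_0_iff:
  fixes h :: "'n::{finite,linorder} tractor_matrix" and I :: "'n tractor"
  assumes N: "alternating (Suc k) N" and card: "Suc k + r = CARD('n tidx)" and h: "invertible h"
  shows "(\<forall>K. length K = Suc r \<longrightarrow>
      skew (Suc r) (\<lambda>K. I $ hd K * hodge_star h (Suc k) N (tl K)) K = 0) \<longleftrightarrow>
    (\<forall>L. length L = k \<longrightarrow> contract (($) I) N L = 0)"
proof -
  \<comment> \<open>\<open>c\<close> collects the factor from raising the volume form and the
    normalisation of the Hodge star. It is nonzero because \<open>h\<close> is invertible.\<close>
  define c where "c = sqrt \<bar>det h\<bar> * det (matrix_inv h) / fact (Suc k)"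
  have "matrix_inv h ** h = mat 1"
    using h by (rule matrix_inv_works(2))
  then have "det (matrix_inv h) \<noteq> 0"
    by (metis det_I det_mul mult_zero_left zero_neq_one)
  then have c: "c \<noteq> 0"
    using h by (simp add: c_def invertible_det_nz)
  have star: "hodge_star h (Suc k) N K = c * (\<Sum>L | length L = Suc k. N L * levi_civita (L @ K))"
    if "length K = r" for K
    using that card unfolding hodge_star_def c_def sum_distrib_left
    by (intro sum.cong refl) (simp add: raise_tractor_volume)
  have scale: "skew (Suc r) (\<lambda>K. I $ hd K * hodge_star h (Suc k) N (tl K)) (x # K) =
      c * skew (Suc r) (\<lambda>K. I $ hd K * (\<Sum>L | length L = Suc k. N L * levi_civita (L @ tl K))) (x # K)"
    if "length K = r" for x K
    using that by (intro skew_scale) (auto simp: length_Suc_conv star)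
  have iff: "skew (Suc r) (\<lambda>K. I $ hd K * hodge_star h (Suc k) N (tl K)) (x # K) = 0 \<longleftrightarrow>
      (\<Sum>L | length L = k. contract (($) I) N L * levi_civita (x # L @ K)) = 0"
    if "length K = r" for x K
  proof -
    have "real (Suc r) * skew (Suc r) (\<lambda>K. I $ hd K * hodge_star h (Suc k) N (tl K)) (x # K) =
        c * (real (Suc k) * (\<Sum>L | length L = k. contract (($) I) N L * levi_civita (x # L @ K)))"
      unfolding scale[OF that] skew_product_dual[OF N levi_civita_alternating card that, of "($) I" x, symmetric]
      by (simp only: mult.left_commute)
    moreover have "a = 0 \<longleftrightarrow> b = 0" if "real (Suc r) * a = c * (real (Suc k) * b)" for a b
      using that c by (auto simp del: of_nat_Suc)
    ultimately show ?thesis by blast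
  qed
  have cons: "(\<forall>K. length K = Suc r \<longrightarrow> P K) \<longleftrightarrow> (\<forall>x K. length K = r \<longrightarrow> P (x # K))"
    for P :: "'n tidx list \<Rightarrow> bool"
    by (auto simp: length_Suc_conv)
  have "(\<forall>K. length K = Suc r \<longrightarrow>
      skew (Suc r) (\<lambda>K. I $ hd K * hodge_star h (Suc k) N (tl K)) K = 0) \<longleftrightarrow>
      (\<forall>x K. length K = r \<longrightarrow> (\<Sum>L | length L = k. contract (($) I) N L * levi_civita (x # L @ K)) = 0)"
    unfolding cons using iff by simp
  also have "\<dots> \<longleftrightarrow> (\<forall>L. length L = k \<longrightarrow> contract (($) I) N L = 0)"
    using dual_eq_0_iff[OF alternating_contract[OF N] levi_civita_alternating levi_civita_nonzero, of r] card
    by simp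
  finally show ?thesis .
qed

section \<open>Bilinear forms and orthogonal projections\<close>

lemma bil_linear:
  "bil B (u + u') v = bil B u v + bil B u' v" "bil B u (v + v') = bil B u v + bil B u v'"
  "bil B (u - u') v = bil B u v - bil B u' v" "bil B u (v - v') = bil B u v - bil B u v'"
  "bil B (c *\<^sub>R u) v = c * bil B u v" "bil B u (c *\<^sub>R v) = c * bil B u v"
  "bil (c *\<^sub>R B) u v = c * bil B u v" "bil B 0 v = 0" "bil B u 0 = 0"
  by (simp_all add: bil_def inner_add_left inner_add_right inner_diff_left inner_diff_right
      matrix_vector_right_distrib matrix_vector_mult_diff_distrib matrix_vector_mult_scaleR
      scaleR_matrix_vector_assoc[symmetric])

lemma bil_sum_left: "bil B (\<Sum>i\<in>S. f i) v = (\<Sum>i\<in>S. bil B (f i) v)"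
  by (simp add: bil_def inner_sum_left)

lemma bil_sum_right: "bil B u (\<Sum>i\<in>S. f i) = (\<Sum>i\<in>S. bil B u (f i))"
  by (induction S rule: infinite_finite_induct) (auto simp: bil_linear)

lemma bil_commute:
  assumes "transpose B = B"
  shows "bil B u v = bil B v u"
proof -
  have "u \<bullet> (B *v v) = (transpose B *v u) \<bullet> v"
    by (simp add: dot_lmul_matrix transpose_matrix_vector)
  then show ?thesis
    unfolding bil_def assms by (simp add: inner_commute)
qed

definition posdef :: "real^'i::finite^'i \<Rightarrow> bool" where
  "posdef B \<longleftrightarrow> transpose B = B \<and> (\<forall>v. v \<noteq> 0 \<longrightarrow> bil B v v > 0)"

lemma posdef_eq_0_iff: "posdef B \<Longrightarrow> bil B v v = 0 \<longleftrightarrow> v = 0"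
  unfolding posdef_def using bil_linear(8)[of B v] by (cases "v = 0") (auto simp: less_le)

lemma posdef_invertible:
  assumes "posdef B"
  shows "invertible B"
proof -
  have "v = 0" if "B *v v = 0" for v
    using posdef_eq_0_iff[OF assms, of v] that by (simp add: bil_def)
  then show ?thesis
    unfolding invertible_left_inverse matrix_left_invertible_ker by blast
qed

text \<open>Two candidates differ by a vector of \<open>E\<close> that is orthogonal to itself.
  Asking only that \<open>E\<close> contain no nonzero null vector makes this applicable to the
  indefinite tractor metric.\<close>

lemma orth_proj_unique:
  assumes E: "subspace E" and nondeg: "\<And>v. v \<in> E \<Longrightarrow> bil B v v = 0 \<Longrightarrow> v = 0"
    and w: "w \<in> E" "\<And>u. u \<in> E \<Longrightarrow> bil B (v - w) u = 0"
  shows "orth_proj B E v = w"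
  unfolding orth_proj_def
proof (rule the_equality)
  fix w' assume w': "w' \<in> E \<and> (\<forall>u\<in>E. bil B (v - w') u = 0)"
  then have "w' - w \<in> E"
    using E w subspace_diff by blast
  moreover have "bil B (w' - w) (w' - w) = bil B (v - w) (w' - w) - bil B (v - w') (w' - w)"
    by (simp add: bil_linear)
  ultimately have "w' - w = 0"
    using w(2) w' by (intro nondeg) simp_all
  then show "w' = w" by simp
qed (use w in auto)

section \<open>Orthogonal complements for a positive definite form\<close>

definition bil_perp :: "real^'i^'i \<Rightarrow> (real^'i) set \<Rightarrow> (real^'i::finite) set" where
  "bil_perp B E = {v. \<forall>u\<in>E. bil B v u = 0}"

lemma subspace_bil_perp: "subspace (bil_perp B E)"
  by (auto simp: bil_perp_def subspace_def bil_linear)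

text \<open>\<open>bil_perp B E\<close> is the Euclidean orthogonal complement of the image of
  \<open>E\<close> under the injective map \<open>B\<close>, which gives its dimension. Positive
  definiteness makes it meet \<open>E\<close> only in 0, so the two subspaces together fill the
  space.\<close>

lemma bil_perp_decomposition:
  fixes B :: "real^'i::finite^'i"
  assumes B: "posdef B" and E: "subspace E"
  shows "dim (bil_perp B E) + dim E = CARD('i)"
    and "\<exists>a\<in>E. \<exists>b\<in>bil_perp B E. v = a + b"
proof -
  have lin: "linear ((*v) B)" by simp
  have inj: "inj ((*v) B)"
    using posdef_invertible[OF B] inj_matrix_vector_mult by blast
  have sub: "subspace ((*v) B ` E)"
    using lin E linear_subspace_image by blast
  have perp: "bil_perp B E = {y \<in> UNIV. \<forall>x\<in>(*v) B ` E. orthogonal x y}"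
    by (auto simp: bil_perp_def bil_def orthogonal_def inner_commute)
  have "dim ((*v) B ` E) = dim E"
    using lin inj by (intro dim_image_eq) (auto intro: inj_on_subset)
  then show dims: "dim (bil_perp B E) + dim E = CARD('i)"
    using dim_subspace_orthogonal_to_vectors[OF sub subspace_UNIV] by (simp add: perp dim_UNIV)
  have "x = 0" if "x \<in> E \<inter> bil_perp B E" for x
    using that posdef_eq_0_iff[OF B] by (auto simp: bil_perp_def)
  then have "E \<inter> bil_perp B E = {0}"
    using E subspace_bil_perp[of B E] subspace_0 by blast
  then have "dim {x + y |x y. x \<in> E \<and> y \<in> bil_perp B E} = CARD('i)"
    using dim_sums_Int[OF E subspace_bil_perp, of B E] dims by simp
  then have "{x + y |x y. x \<in> E \<and> y \<in> bil_perp B E} = UNIV"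
    using dim_eq_full[of "{x + y |x y. x \<in> E \<and> y \<in> bil_perp B E}"]
      span_eq_iff[THEN iffD2, OF subspace_sums[OF E subspace_bil_perp, of B E]] by simp
  then show "\<exists>a\<in>E. \<exists>b\<in>bil_perp B E. v = a + b"
    by blast
qed

lemma orth_proj_perp:
  assumes B: "posdef B" and E: "subspace E"
  shows "orth_proj B (bil_perp B E) v \<in> bil_perp B E"
    and "u \<in> bil_perp B E \<Longrightarrow> bil B u (orth_proj B (bil_perp B E) v) = bil B u v"
    and "v - orth_proj B (bil_perp B E) v \<in> E"
proof -
  obtain a b where ab: "a \<in> E" "b \<in> bil_perp B E" "v = a + b"
    using bil_perp_decomposition(2)[OF assms] by blast
  have comm: "bil B x y = bil B y x" for x y
    using B by (intro bil_commute) (simp add: posdef_def)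
  have "bil B (v - b) u = 0" if "u \<in> bil_perp B E" for u
    using that ab comm[of a u] by (simp add: bil_perp_def)
  then have b: "orth_proj B (bil_perp B E) v = b"
    using ab posdef_eq_0_iff[OF B] by (intro orth_proj_unique subspace_bil_perp) auto
  show "orth_proj B (bil_perp B E) v \<in> bil_perp B E"
    using b ab by simp
  show "v - orth_proj B (bil_perp B E) v \<in> E"
    using b ab by simp
  show "bil B u (orth_proj B (bil_perp B E) v) = bil B u v" if "u \<in> bil_perp B E"
    using that b ab by (simp add: bil_linear bil_perp_def)
qed

lemma orth_proj_perp_eqI:
  assumes B: "posdef B" and E: "subspace E" and w: "w \<in> bil_perp B E" "v - w \<in> E"
  shows "orth_proj B (bil_perp B E) v = w"
proof (rule orth_proj_unique[OF subspace_bil_perp _ w(1)])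
  show "bil B (v - w) u = 0" if "u \<in> bil_perp B E" for u
    using that w(2) B bil_commute[of B "v - w" u] by (simp add: bil_perp_def posdef_def)
qed (use posdef_eq_0_iff[OF B] in auto)

section \<open>Behaviour under rescaling\<close>

lemma orth_proj_scaled:
  assumes "c \<noteq> 0"
  shows "orth_proj (c *\<^sub>R B) E v = orth_proj B E v"
  using assms by (simp add: orth_proj_def bil_linear)

lemma matrix_inv_scaled:
  fixes B :: "real^'i::finite^'i"
  assumes "invertible B" "c \<noteq> 0"
  shows "matrix_inv (c *\<^sub>R B) = (1 / c) *\<^sub>R matrix_inv B"
proof (rule matrix_inv_unique)
  have "(c *\<^sub>R B) ** ((1 / c) *\<^sub>R matrix_inv B) = B ** matrix_inv B"
    using assms by (simp add: matrix_matrix_mult_def vec_eq_iff)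
  then show "(c *\<^sub>R B) ** ((1 / c) *\<^sub>R matrix_inv B) = mat 1"
    using matrix_inv_works(1)[OF assms(1)] by simp
qed

lemma pd_scaled:
  fixes \<omega> f :: "real^'n::finite \<Rightarrow> real"
  assumes "\<omega> differentiable (at x)" "f differentiable (at x)"
  shows "pd i (\<lambda>z. (\<omega> z)\<^sup>2 * f z) x = 2 * \<omega> x * pd i \<omega> x * f x + (\<omega> x)\<^sup>2 * pd i f x"
proof -
  have "(\<omega> has_derivative frechet_derivative \<omega> (at x)) (at x)"
    and "(f has_derivative frechet_derivative f (at x)) (at x)"
    using assms frechet_derivative_works by auto
  then have "((\<lambda>z. (\<omega> z)\<^sup>2 * f z) has_derivative
      (\<lambda>v. 2 * \<omega> x * frechet_derivative \<omega> (at x) v * f x + (\<omega> x)\<^sup>2 * frechet_derivative f (at x) v)) (at x)"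
    by (auto intro!: derivative_eq_intros simp: algebra_simps)
  then have fd: "(\<lambda>v. 2 * \<omega> x * frechet_derivative \<omega> (at x) v * f x + (\<omega> x)\<^sup>2 * frechet_derivative f (at x) v)
      = frechet_derivative (\<lambda>z. (\<omega> z)\<^sup>2 * f z) (at x)"
    by (rule frechet_derivative_at)
  then show ?thesis
    using fun_cong[OF fd, of "axis i 1"] unfolding pd_def by (simp only:)
qed

section \<open>Conformal change of the mean curvature\<close>

text \<open>The classical conformal transformation law. The product rule adds
  \<open>2 * \<Upsilon> $ a\<close> times the metric to its derivative; the common factor
  \<open>(\<omega> x)\<^sup>2\<close> cancels against the inverse metric, and contracting the
  inverse with \<open>G x\<close> leaves Kronecker deltas.\<close>

lemma christoffel_rescaled:
  fixes G :: "'n::finite metric_matrix"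
  assumes G: "posdef (G x)" and dG: "\<And>i j. (\<lambda>z. G z $ i $ j) differentiable (at x)"
    and d\<omega>: "\<omega> differentiable (at x)" and \<omega>: "\<omega> x \<noteq> 0" and \<Upsilon>: "\<Upsilon> = (\<chi> a. pd a \<omega> x / \<omega> x)"
  shows "christoffel (\<lambda>z. (\<omega> z)\<^sup>2 *\<^sub>R G z) x k i j = christoffel G x k i j +
    (\<Upsilon> $ i * (if k = j then 1 else 0) + \<Upsilon> $ j * (if k = i then 1 else 0)
      - G x $ i $ j * (matrix_inv (G x) *v \<Upsilon>) $ k)"
proof -
  let ?H = "matrix_inv (G x)"
  have sym: "G x $ a $ b = G x $ b $ a" for a b
  proof -
    have "transpose (G x) $ a $ b = G x $ a $ b"
      using G by (simp add: posdef_def)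
    then show ?thesis by (simp add: transpose_def)
  qed
  have HG: "(\<Sum>l\<in>UNIV. ?H $ k $ l * G x $ a $ l) = (if k = a then 1 else 0)" for a
  proof -
    have "(\<Sum>l\<in>UNIV. ?H $ k $ l * G x $ a $ l) = (\<Sum>l\<in>UNIV. ?H $ k $ l * G x $ l $ a)"
      by (intro sum.cong refl) (simp only: sym)
    also have "\<dots> = (?H ** G x) $ k $ a"
      by (simp add: matrix_matrix_mult_def)
    finally show ?thesis
      using matrix_inv_works(2)[OF posdef_invertible[OF G]] by (simp add: mat_def)
  qed
  have d\<omega>_eq: "pd a \<omega> x = \<omega> x * \<Upsilon> $ a" for a
    using \<omega> by (simp add: \<Upsilon>)
  have summand: "matrix_inv ((\<omega> x)\<^sup>2 *\<^sub>R G x) $ k $ l *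
      (pd i (\<lambda>z. ((\<omega> z)\<^sup>2 *\<^sub>R G z) $ j $ l) x + pd j (\<lambda>z. ((\<omega> z)\<^sup>2 *\<^sub>R G z) $ i $ l) x
        - pd l (\<lambda>z. ((\<omega> z)\<^sup>2 *\<^sub>R G z) $ i $ j) x) =
      ?H $ k $ l * (pd i (\<lambda>z. G z $ j $ l) x + pd j (\<lambda>z. G z $ i $ l) x - pd l (\<lambda>z. G z $ i $ j) x) +
      2 * (\<Upsilon> $ i * (?H $ k $ l * G x $ j $ l) + \<Upsilon> $ j * (?H $ k $ l * G x $ i $ l)
        - G x $ i $ j * (?H $ k $ l * \<Upsilon> $ l))" for l
  proof -
    have "pd a (\<lambda>z. ((\<omega> z)\<^sup>2 *\<^sub>R G z) $ b $ c) x =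
        (\<omega> x)\<^sup>2 * (2 * \<Upsilon> $ a * G x $ b $ c + pd a (\<lambda>z. G z $ b $ c) x)" for a b c
      using pd_scaled[OF d\<omega> dG, of a b c] by (simp add: d\<omega>_eq power2_eq_square algebra_simps)
    then show ?thesis
      using \<omega> by (simp add: matrix_inv_scaled[OF posdef_invertible[OF G]] field_simps)
  qed
  have "christoffel (\<lambda>z. (\<omega> z)\<^sup>2 *\<^sub>R G z) x k i j = christoffel G x k i j +
      (\<Sum>l\<in>UNIV. \<Upsilon> $ i * (?H $ k $ l * G x $ j $ l) + \<Upsilon> $ j * (?H $ k $ l * G x $ i $ l)
        - G x $ i $ j * (?H $ k $ l * \<Upsilon> $ l))"
    unfolding christoffel_def summand sum.distrib sum_distrib_left[symmetric] by simp
  also have "(\<Sum>l\<in>UNIV. \<Upsilon> $ i * (?H $ k $ l * G x $ j $ l) + \<Upsilon> $ j * (?H $ k $ l * G x $ i $ l)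
        - G x $ i $ j * (?H $ k $ l * \<Upsilon> $ l)) =
      \<Upsilon> $ i * (if k = j then 1 else 0) + \<Upsilon> $ j * (if k = i then 1 else 0)
      - G x $ i $ j * (?H *v \<Upsilon>) $ k"
    unfolding sum.distrib sum_subtractf sum_distrib_left[symmetric] HG matrix_vector_mult_def by simp
  finally show ?thesis .
qed

lemma bil_components: "bil B u v = (\<Sum>a\<in>UNIV. \<Sum>b\<in>UNIV. B $ a $ b * u $ a * v $ b)"
  by (simp add: bil_def inner_vec_def matrix_vector_mult_def sum_distrib_left mult_ac)

text \<open>The situation at one point, in one ambient chart, one chart of the submanifold and one
  scale. Smoothness enters as differentiability at the point, and \<open>inj_dF\<close> is the
  immersion property there.\<close>

locale conformal_point =
  fixes G :: "'n::{finite,linorder} metric_matrix" and \<omega> :: "'n coords \<Rightarrow> real"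
    and F :: "('m::{finite,linorder}, 'n) parametrization" and y :: "'m coords"
  assumes G: "posdef (G (F y))"
    and dG: "\<And>i j. (\<lambda>z. G z $ i $ j) differentiable (at (F y))"
    and d\<omega>: "\<omega> differentiable (at (F y))" and \<omega>: "\<omega> (F y) > 0"
    and dF: "F differentiable (at y)" and inj_dF: "inj (frechet_derivative F (at y))"
begin

abbreviation (input) "B \<equiv> G (F y)"
abbreviation (input) "r \<equiv> \<omega> (F y)"
abbreviation (input) "E \<equiv> tangent_space F y"
abbreviation (input) "Gc \<equiv> \<lambda>z. (\<omega> z)\<^sup>2 *\<^sub>R G z"
abbreviation (input) "H \<equiv> mean_curvature G F y"

definition \<Upsilon> :: "'n coords" where "\<Upsilon> = (\<chi> a. pd a \<omega> (F y) / \<omega> (F y))"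

text \<open>The gradient of the logarithm of \<open>\<omega>\<close> with respect to
  \<open>G\<close>.\<close>

definition grad :: "'n coords" where "grad = matrix_inv B *v \<Upsilon>"

lemma bil_B_commute: "bil B u v = bil B v u"
  using G by (intro bil_commute) (simp add: posdef_def)

lemma bil_grad: "bil B u grad = u \<bullet> \<Upsilon>"
  unfolding bil_def grad_def
  by (simp add: matrix_vector_mul_assoc matrix_inv_works posdef_invertible[OF G])

lemma subspace_tangent: "subspace E"
  by (simp add: tangent_space_def)

lemma normal_space_eq: "normal_space G F y = bil_perp B E"
  by (simp add: normal_space_def bil_perp_def)

lemma normal_space_rescaled: "normal_space Gc F y = normal_space G F y"
  using \<omega> by (simp add: normal_space_def bil_linear)

lemma linear_dF: "linear (frechet_derivative F (at y))"
  using dF by (simp add: linear_frechet_derivative)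

lemma dF_expansion: "frechet_derivative F (at y) v = (\<Sum>i\<in>UNIV. v $ i *\<^sub>R pd i F y)"
proof -
  have "frechet_derivative F (at y) v = frechet_derivative F (at y) (\<Sum>i\<in>UNIV. v $ i *\<^sub>R axis i 1)"
    using basis_expansion[of v] by (simp add: scalar_mult_eq_scaleR)
  then show ?thesis
    by (simp add: linear_sum[OF linear_dF] linear_cmul[OF linear_dF] pd_def)
qed

lemma tangent_space_eq: "E = range (frechet_derivative F (at y))"
proof
  have "subspace (range (frechet_derivative F (at y)))"
    using linear_dF linear_subspace_image subspace_UNIV by blast
  then show "E \<subseteq> range (frechet_derivative F (at y))"
    unfolding tangent_space_def by (intro span_minimal) (auto simp: pd_def)
  show "range (frechet_derivative F (at y)) \<subseteq> E"
    unfolding tangent_space_def dF_expansion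
    by (rule image_subsetI, rule span_sum, rule span_scale, rule span_base, rule rangeI)
qed

lemma dim_tangent: "dim E = CARD('m)"
  using dim_image_eq[OF linear_dF, of UNIV] inj_dF by (simp add: tangent_space_eq)

lemma pd_tangent: "pd i F y \<in> E"
  by (simp add: tangent_space_def span_base)

lemma first_ff_mult: "w \<bullet> (first_ff G F y *v v) = bil B (frechet_derivative F (at y) w) (frechet_derivative F (at y) v)"
proof -
  have "w \<bullet> (first_ff G F y *v v) = (\<Sum>a\<in>UNIV. \<Sum>b\<in>UNIV. first_ff G F y $ a $ b * w $ a * v $ b)"
    unfolding bil_def[symmetric] by (rule bil_components)
  also have "\<dots> = bil B (frechet_derivative F (at y) w) (frechet_derivative F (at y) v)"
    unfolding dF_expansion bil_sum_left bil_sum_right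
    by (subst sum.swap) (simp add: bil_linear first_ff_def sum_distrib_left mult_ac)
  finally show ?thesis .
qed

text \<open>The first fundamental form is a Gram matrix: a kernel vector is mapped to a tangent
  vector of length 0, and \<open>F\<close> is an immersion.\<close>

lemma first_ff_invertible: "invertible (first_ff G F y)"
proof -
  have "v = 0" if v: "first_ff G F y *v v = 0" for v
  proof -
    have "bil B (frechet_derivative F (at y) v) (frechet_derivative F (at y) v) = 0"
      unfolding first_ff_mult[symmetric] v by simp
    then have "frechet_derivative F (at y) v = frechet_derivative F (at y) 0"
      using posdef_eq_0_iff[OF G] linear_0[OF linear_dF] by simp
    then show ?thesis
      using inj_dF by (rule injD[rotated])
  qed
  then show ?thesis
    unfolding invertible_left_inverse matrix_left_invertible_ker by blast
qed

lemma first_ff_rescaled: "first_ff Gc F y = r\<^sup>2 *\<^sub>R first_ff G F y"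
  by (simp add: first_ff_def vec_eq_iff bil_linear)

text \<open>This value cancels the normalising factor of the mean curvature when the gradient term
  of \<open>second_ff_rescaled\<close> is traced. Symmetry turns the double sum into the trace of a
  matrix product.\<close>

lemma trace_first_ff: "(\<Sum>i\<in>UNIV. \<Sum>j\<in>UNIV. matrix_inv (first_ff G F y) $ i $ j * first_ff G F y $ i $ j) = CARD('m)"
proof -
  have "first_ff G F y $ i $ j = first_ff G F y $ j $ i" for i j
    by (simp add: first_ff_def bil_B_commute)
  then have "(\<Sum>i\<in>UNIV. \<Sum>j\<in>UNIV. matrix_inv (first_ff G F y) $ i $ j * first_ff G F y $ i $ j)
      = (\<Sum>i\<in>UNIV. \<Sum>j\<in>UNIV. matrix_inv (first_ff G F y) $ i $ j * first_ff G F y $ j $ i)"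
    by (intro sum.cong refl arg_cong2[of _ _ _ _ "(*)"])
  also have "\<dots> = (\<Sum>i\<in>UNIV. (matrix_inv (first_ff G F y) ** first_ff G F y) $ i $ i)"
    by (simp add: matrix_matrix_mult_def)
  finally show ?thesis
    by (simp add: matrix_inv_works[OF first_ff_invertible] mat_def)
qed

lemma mean_curvature_normal: "H \<in> normal_space G F y"
proof -
  have "second_ff G F y i j \<in> normal_space G F y" for i j
    unfolding second_ff_def normal_space_eq by (rule orth_proj_perp[OF G subspace_tangent])
  then show ?thesis
    unfolding mean_curvature_def normal_space_eq
    by (intro subspace_scale subspace_sum subspace_bil_perp) auto
qed

abbreviation (input) "gradN \<equiv> orth_proj B (normal_space G F y) grad"

text \<open>The change of the Christoffel symbols adds two tangential vectors, which the normal
  projection kills, and a multiple of \<open>grad\<close>, of which the normal part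
  survives.\<close>

lemma second_ff_rescaled: "second_ff Gc F y i j = second_ff G F y i j - first_ff G F y $ i $ j *\<^sub>R gradN"
proof -
  \<comment> \<open>\<open>W K\<close> is the vector whose normal projection is the second
    fundamental form for \<open>K\<close>.\<close>
  define W where "W K = (\<chi> k. pd i (\<lambda>z. pd j F z $ k) y +
      (\<Sum>a\<in>UNIV. \<Sum>b\<in>UNIV. christoffel K (F y) k a b * pd i F y $ a * pd j F y $ b))"
    for K :: "'n metric_matrix"
  have "W Gc $ k = (W G + (\<Upsilon> \<bullet> pd i F y) *\<^sub>R pd j F y + (\<Upsilon> \<bullet> pd j F y) *\<^sub>R pd i F y
      - first_ff G F y $ i $ j *\<^sub>R grad) $ k" for k
  proof -
    \<comment> \<open>The Kronecker deltas stay as conditionals, so that the two middle double sums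
      collapse to multiples of coordinate tangent vectors.\<close>
    have "(\<Sum>a\<in>UNIV. \<Sum>b\<in>UNIV. christoffel Gc (F y) k a b * pd i F y $ a * pd j F y $ b)
        = (\<Sum>a\<in>UNIV. \<Sum>b\<in>UNIV. christoffel G (F y) k a b * pd i F y $ a * pd j F y $ b)
        + (\<Sum>a\<in>UNIV. \<Sum>b\<in>UNIV. (if k = b then \<Upsilon> $ a * pd i F y $ a * pd j F y $ b else 0))
        + (\<Sum>a\<in>UNIV. \<Sum>b\<in>UNIV. (if k = a then \<Upsilon> $ b * pd i F y $ a * pd j F y $ b else 0))
        - (\<Sum>a\<in>UNIV. \<Sum>b\<in>UNIV. grad $ k * (B $ a $ b * pd i F y $ a * pd j F y $ b))"
      unfolding sum.distrib[symmetric] sum_subtractf[symmetric]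
      using \<omega> by (intro sum.cong refl) 
        (simp add: christoffel_rescaled[OF G dG d\<omega> _ \<Upsilon>_def] grad_def algebra_simps)
    moreover have "(\<Sum>a\<in>UNIV. \<Sum>b\<in>UNIV. (if k = b then \<Upsilon> $ a * pd i F y $ a * pd j F y $ b else 0))
        = (\<Upsilon> \<bullet> pd i F y) * pd j F y $ k"
      by (simp add: inner_vec_def sum_distrib_right)
    moreover have "(\<Sum>a\<in>UNIV. \<Sum>b\<in>UNIV. (if k = a then \<Upsilon> $ b * pd i F y $ a * pd j F y $ b else 0))
        = (\<Upsilon> \<bullet> pd j F y) * pd i F y $ k"
      by (subst sum.swap) (simp add: inner_vec_def sum_distrib_left mult_ac)
    moreover have "(\<Sum>a\<in>UNIV. \<Sum>b\<in>UNIV. grad $ k * (B $ a $ b * pd i F y $ a * pd j F y $ b))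
        = first_ff G F y $ i $ j * grad $ k"
      by (simp add: first_ff_def bil_components sum_distrib_left[symmetric])
    ultimately show ?thesis
      by (simp add: W_def)
  qed
  then have W: "W Gc = W G + (\<Upsilon> \<bullet> pd i F y) *\<^sub>R pd j F y + (\<Upsilon> \<bullet> pd j F y) *\<^sub>R pd i F y
      - first_ff G F y $ i $ j *\<^sub>R grad"
    by (simp add: vec_eq_iff)
  let ?P = "orth_proj B (bil_perp B E)"
  note P = orth_proj_perp[OF G subspace_tangent]
  have "?P (W Gc) = ?P (W G) - first_ff G F y $ i $ j *\<^sub>R ?P grad"
  proof (rule orth_proj_perp_eqI[OF G subspace_tangent])
    show "?P (W G) - first_ff G F y $ i $ j *\<^sub>R ?P grad \<in> bil_perp B E"
      by (intro subspace_diff subspace_scale subspace_bil_perp P)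
    \<comment> \<open>Every term here is tangential: two remainders of projections and multiples of
      coordinate tangent vectors.\<close>
    have "(W G - ?P (W G)) + (\<Upsilon> \<bullet> pd i F y) *\<^sub>R pd j F y + (\<Upsilon> \<bullet> pd j F y) *\<^sub>R pd i F y
      - first_ff G F y $ i $ j *\<^sub>R (grad - ?P grad) \<in> E"
      by (intro subspace_diff subspace_add subspace_scale subspace_tangent P pd_tangent)
    then show "W Gc - (?P (W G) - first_ff G F y $ i $ j *\<^sub>R ?P grad) \<in> E"
      unfolding W by (simp add: algebra_simps)
  qed
  then show ?thesis
    using \<omega> unfolding second_ff_def W_def[symmetric] normal_space_rescaled normal_space_eq
    by (simp add: orth_proj_scaled)
qed

text \<open>The factor \<open>1 / r\<^sup>2\<close> comes from the inverse of the induced metric;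
  tracing the first fundamental form in \<open>second_ff_rescaled\<close> leaves one copy of
  \<open>gradN\<close>.\<close>

lemma mean_curvature_rescaled: "mean_curvature Gc F y = (1 / r\<^sup>2) *\<^sub>R (H - gradN)"
proof -
  let ?f = "matrix_inv (first_ff G F y)"
  have inv: "matrix_inv (first_ff Gc F y) = (1 / r\<^sup>2) *\<^sub>R ?f"
    using \<omega> unfolding first_ff_rescaled by (intro matrix_inv_scaled first_ff_invertible) simp
  have "(\<Sum>i\<in>UNIV. \<Sum>j\<in>UNIV. (?f $ i $ j * first_ff G F y $ i $ j) *\<^sub>R gradN) = real CARD('m) *\<^sub>R gradN"
    unfolding scaleR_sum_left[symmetric] trace_first_ff ..
  moreover have "matrix_inv (first_ff Gc F y) $ i $ j *\<^sub>R second_ff Gc F y i j =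
      (1 / r\<^sup>2) *\<^sub>R (?f $ i $ j *\<^sub>R second_ff G F y i j - (?f $ i $ j * first_ff G F y $ i $ j) *\<^sub>R gradN)" for i j
    unfolding second_ff_rescaled inv by (simp add: scaleR_right_diff_distrib)
  ultimately have "(\<Sum>i\<in>UNIV. \<Sum>j\<in>UNIV. matrix_inv (first_ff Gc F y) $ i $ j *\<^sub>R second_ff Gc F y i j)
      = (1 / r\<^sup>2) *\<^sub>R ((\<Sum>i\<in>UNIV. \<Sum>j\<in>UNIV. ?f $ i $ j *\<^sub>R second_ff G F y i j) - real CARD('m) *\<^sub>R gradN)"
    by (simp only: scaleR_sum_right[symmetric] sum_subtractf)
  then show ?thesis
    unfolding mean_curvature_def by (simp add: scaleR_right_diff_distrib)
qed

end

section \<open>Tractors along a submanifold\<close>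

lemma bil_tractor_metric:
  "bil (tractor_metric K x) V W = V $ Tsig * W $ Trho + V $ Trho * W $ Tsig +
    bil (matrix_inv (K x)) (\<chi> a. V $ Tmu a) (\<chi> a. W $ Tmu a)"
  by (simp add: bil_components sum_tidx tractor_metric_def sum.distrib)

text \<open>On the kernel the outer slots vanish because the tractor metric exchanges them, and the
  middle slot because the inverse metric acting on it can be undone by \<open>K x\<close>.\<close>

lemma tractor_metric_invertible:
  assumes "invertible (K x)"
  shows "invertible (tractor_metric K x)"
proof -
  have "V = 0" if V: "tractor_metric K x *v V = 0" for V
  proof -
    have "(tractor_metric K x *v V) $ Tsig = V $ Trho" "(tractor_metric K x *v V) $ Trho = V $ Tsig"
      by (simp_all add: matrix_vector_mult_def sum_tidx tractor_metric_def)
    moreover have "(\<chi> a. (tractor_metric K x *v V) $ Tmu a) = matrix_inv (K x) *v (\<chi> a. V $ Tmu a)"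
      by (simp add: vec_eq_iff matrix_vector_mult_def sum_tidx tractor_metric_def)
    then have "K x *v (matrix_inv (K x) *v (\<chi> a. V $ Tmu a)) = 0"
      unfolding V by (simp add: vec_eq_iff matrix_vector_mult_def)
    then have "(\<chi> a. V $ Tmu a) = 0"
      by (simp add: matrix_vector_mul_assoc matrix_inv_works[OF assms])
    ultimately have "V $ K = 0" for K
      unfolding V by (cases K) (simp_all add: vec_eq_iff)
    then show "V = 0"
      by (simp add: vec_eq_iff)
  qed
  then show ?thesis
    unfolding invertible_left_inverse matrix_left_invertible_ker by blast
qed

lemma linear_normal_to_tractor: "linear (normal_to_tractor K F y)"
proof (rule linearI)
  show "normal_to_tractor K F y (u + v) = normal_to_tractor K F y u + normal_to_tractor K F y v" for u v
    unfolding vec_eq_iff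
  proof
    show "normal_to_tractor K F y (u + v) $ L = (normal_to_tractor K F y u + normal_to_tractor K F y v) $ L" for L
      by (cases L) (simp_all add: normal_to_tractor_def bil_linear matrix_vector_right_distrib)
  qed
  show "normal_to_tractor K F y (c *\<^sub>R u) = c *\<^sub>R normal_to_tractor K F y u" for c u
    unfolding vec_eq_iff
  proof
    show "normal_to_tractor K F y (c *\<^sub>R u) $ L = (c *\<^sub>R normal_to_tractor K F y u) $ L" for L
      by (cases L) (simp_all add: normal_to_tractor_def bil_linear matrix_vector_mult_scaleR)
  qed
qed

section \<open>Evaluation of forms and oriented normal frames\<close>

lemma tensor_eval_Cons:
  "tensor_eval T (V # Vs) =
    (\<Sum>K | length K = length Vs. contract (($) V) T K * (\<Prod>k<length Vs. Vs ! k $ (K ! k)))"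
proof -
  have "tensor_eval T (V # Vs) = (\<Sum>l\<in>UNIV. \<Sum>K | length K = length Vs.
      (V $ l * T (l # K)) * (\<Prod>k<length Vs. Vs ! k $ (K ! k)))"
    unfolding tensor_eval_def length_Cons sum_lists_Suc prod.lessThan_Suc_shift by (simp add: mult_ac)
  also have "\<dots> = (\<Sum>K | length K = length Vs. \<Sum>l\<in>UNIV.
      (V $ l * T (l # K)) * (\<Prod>k<length Vs. Vs ! k $ (K ! k)))"
    by (rule sum.swap)
  finally show ?thesis
    unfolding contract_def sum_distrib_right .
qed

text \<open>\<open>u\<close> is extended to a basis of the normal space. Behind the tangent frame
  this has nonzero determinant, whose sign is corrected by rescaling \<open>u\<close>, a choice that
  also works in codimension 1.\<close>

lemma oriented_normal_frame_exists:
  fixes G :: "'n::{finite,linorder} metric_matrix" and F :: "('m::{finite,linorder}, 'n) parametrization"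
  assumes G: "posdef (G (F y))" and dim: "dim (tangent_space F y) = CARD('m)"
    and u: "u \<in> normal_space G F y" "u \<noteq> 0"
  shows "\<exists>c vs. oriented_normal_frame G F y (c *\<^sub>R u # vs)"
proof -
  let ?E = "tangent_space F y" and ?N = "normal_space G F y"
  have N: "?N = bil_perp (G (F y)) ?E"
    by (simp add: normal_space_def bil_perp_def)
  have E: "subspace ?E" by (simp add: tangent_space_def)
  have dimN: "dim ?N + CARD('m) = CARD('n)"
    using bil_perp_decomposition(1)[OF G E] unfolding N dim .
  obtain b where b: "{u} \<subseteq> b" "b \<subseteq> ?N" "independent b" "?N \<subseteq> span b"
    by (rule maximal_independent_subset_extend[of "{u}" ?N]) (use u in auto)
  have fin: "finite b" and card: "card b = dim ?N"
    by (rule independent_imp_finite[OF b(3)], rule basis_card_eq_dim[OF b(2,4,3)])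
  obtain vs where vs: "set vs = b - {u}" "distinct vs"
    using finite_distinct_list[OF finite_Diff[OF fin]] by blast
  have "Suc (card (b - {u})) = card b"
    using b(1) fin by (intro card_Suc_Diff1) auto
  then have len: "Suc (length vs) = CARD('n) - CARD('m)" "CARD('m) < CARD('n)"
    using distinct_card[OF vs(2)] vs(1) card dimN by auto
  define t where "t = map (\<lambda>i. pd i F y) (sorted_list_of_set (UNIV :: 'm set))"
  have t: "length t = CARD('m)" "set t = range (\<lambda>i. pd i F y)"
    by (auto simp: t_def)
  define A where "A c = (\<chi> i. (t @ (c *\<^sub>R u) # vs) ! index_pos (i :: 'n))" for c
  \<comment> \<open>The tangent vectors occupy the positions below \<open>CARD('m)\<close>, so
    \<open>k0\<close> is the row with the multiple of \<open>u\<close>; the determinant is linear in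
    this row.\<close>
  obtain k0 :: 'n where k0: "index_pos k0 = CARD('m)"
    by (rule index_pos_surj[OF len(2)])
  have k0_iff: "index_pos i = CARD('m) \<longleftrightarrow> i = k0" for i
    unfolding k0[symmetric] by (rule index_pos_eq_iff)
  have "A c = (\<chi> i. if i = k0 then c *s A 1 $ i else A 1 $ i)" for c
  proof -
    have "A c $ i = (if i = k0 then c *s A 1 $ i else A 1 $ i)" for i
    proof (cases "i = k0")
      case False
      then have "index_pos i \<noteq> length t" using k0_iff t by simp
      then have "(t @ (c *\<^sub>R u) # vs) ! index_pos i = (t @ (1 *\<^sub>R u) # vs) ! index_pos i"
        by (auto simp: nth_append nth_Cons split: nat.split)
      then show ?thesis using False by (simp add: A_def)
    qed (use k0 t in \<open>simp add: A_def nth_append scalar_mult_eq_scaleR\<close>)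
    then show ?thesis by (simp add: vec_eq_iff)
  qed
  then have det: "det (A c) = c * det (A 1)" for c
    using det_row_mul[of k0 c "\<lambda>i. A 1 $ i" "\<lambda>i. A 1 $ i"] by simp
  \<comment> \<open>The rows include a spanning set of the tangent space and a basis of its
    complement.\<close>
  have "span (rows (A 1)) = UNIV"
  proof -
    have "x \<in> rows (A 1)" if x: "x \<in> set (t @ u # vs)" for x
    proof -
      obtain k where k: "k < length (t @ u # vs)" "(t @ u # vs) ! k = x"
        using iffD1[OF in_set_conv_nth x] by (elim exE conjE)
      then have "k < CARD('n)" using t len by simp
      then obtain i :: 'n where "index_pos i = k"
        by (rule index_pos_surj)
      then have "row i (A 1) = x"
        using k by (simp add: row_def A_def)
      then show ?thesis by (auto simp: rows_def)
    qed
    then have sub: "range (\<lambda>i. pd i F y) \<subseteq> rows (A 1)" "b \<subseteq> rows (A 1)"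
      using t vs b by auto
    have "v \<in> span (rows (A 1))" for v
    proof -
      obtain x z where xz: "x \<in> ?E" "z \<in> ?N" "v = x + z"
        using bil_perp_decomposition(2)[OF G E] unfolding N by blast
      have "x \<in> span (rows (A 1))"
        using xz(1) span_mono[OF sub(1)] by (auto simp: tangent_space_def)
      moreover have "z \<in> span (rows (A 1))"
        using xz(2) b(4) span_mono[OF sub(2)] by auto
      ultimately show ?thesis
        unfolding xz(3) by (rule span_add)
    qed
    then show ?thesis by auto
  qed
  then have det1: "det (A 1) \<noteq> 0"
    unfolding invertible_det_nz[symmetric] invertible_left_inverse matrix_left_invertible_span_rows .
  have "frame_det (t @ (c *\<^sub>R u) # vs) = c * det (A 1)" for c
    unfolding frame_det_def A_def[symmetric] by (rule det)
  then have "frame_det (t @ (sgn (det (A 1)) *\<^sub>R u) # vs) > 0"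
    using det1 by (simp add: mult_sgn_abs sgn_mult_abs sgn_if)
  moreover have "set (sgn (det (A 1)) *\<^sub>R u # vs) \<subseteq> ?N"
    using u vs b subspace_scale[OF subspace_bil_perp] unfolding N by auto
  ultimately have "oriented_normal_frame G F y (sgn (det (A 1)) *\<^sub>R u # vs)"
    using len by (simp add: oriented_normal_frame_def t_def)
  then show ?thesis by blast
qed

section \<open>Pairing of the scale tractor with normal tractors\<close>

context conformal_point
begin

abbreviation (input) "NT \<equiv> normal_to_tractor Gc F y"
abbreviation (input) "hc \<equiv> tractor_metric Gc (F y)"
text \<open>This is the mean curvature tractor in the splitting by the rescaled metric: the scale
  has weight 1 and the mean curvature vector weight -2, so \<open>H\<close> is divided by
  \<open>r\<close>.\<close>

abbreviation (input) "w \<equiv> NT ((1 / r) *\<^sub>R H)"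

lemma Gc_posdef: "posdef (Gc (F y))"
  using G \<omega> by (simp add: posdef_def bil_linear transpose_scalar)

lemma normal_tractors_eq: "normal_tractors Gc F y = NT ` normal_space G F y"
  by (simp add: normal_tractors_def normal_space_rescaled)

text \<open>The middle slot of \<open>NT u\<close> is \<open>u\<close> with its index lowered. The
  inverse metric in \<open>hc\<close> raises it again, so the middle slots pair without any
  metric.\<close>

lemma pair_normal_tractor:
  "bil hc V (NT u) = V $ Tsig * bil (Gc (F y)) u (mean_curvature Gc F y) + (\<chi> a. V $ Tmu a) \<bullet> u"
proof -
  have "(\<chi> a. NT u $ Tmu a) = Gc (F y) *v u"
    by (simp add: normal_to_tractor_def vec_eq_iff)
  then have "bil (matrix_inv (Gc (F y))) (\<chi> a. V $ Tmu a) (\<chi> a. NT u $ Tmu a) = (\<chi> a. V $ Tmu a) \<bullet> u"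
    using matrix_inv_works(2)[OF posdef_invertible[OF Gc_posdef]]
    by (simp only: bil_def matrix_vector_mul_assoc matrix_vector_mul_lid)
  then show ?thesis
    unfolding bil_tractor_metric by (simp add: normal_to_tractor_def)
qed

text \<open>The outer slots contribute nothing, since normal tractors have first slot 0. So
  \<open>NT\<close> is an isometry for the rescaled metric, and \<open>hc\<close> is positive
  definite on normal tractors.\<close>

lemma pair_normal_tractors: "bil hc (NT v) (NT u) = r\<^sup>2 * bil B v u"
proof -
  have "(\<chi> a. NT v $ Tmu a) = Gc (F y) *v v"
    by (simp add: normal_to_tractor_def vec_eq_iff)
  then have "(\<chi> a. NT v $ Tmu a) \<bullet> u = bil (Gc (F y)) u v"
    by (simp only: bil_def inner_commute)
  then show ?thesis
    unfolding pair_normal_tractor by (simp add: normal_to_tractor_def bil_linear bil_B_commute)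
qed

lemma normal_tractor_eq_0_iff: "NT u = 0 \<longleftrightarrow> u = 0"
proof
  assume "NT u = 0"
  then have "r\<^sup>2 * bil B u u = 0"
    by (simp add: bil_linear flip: pair_normal_tractors)
  then show "u = 0"
    using \<omega> posdef_eq_0_iff[OF G] by simp
qed (simp add: linear_0[OF linear_normal_to_tractor])

text \<open>\<open>V\<close> stands for the scale tractor of \<open>G\<close> in the splitting by
  \<open>G\<close>, fixed in the two slots which a tractor with first slot 0 pairs with.\<close>

context
  fixes V I :: "'n tractor"
  assumes V: "V $ Tsig = 1" "\<And>a. V $ Tmu a = 0" and I: "I = tractor_change G \<omega> (F y) V"
begin

text \<open>The first slot \<open>r\<close> meets the rescaled mean curvature, where
  \<open>r\<^sup>2\<close> cancels and \<open>- r * bil B u gradN\<close> appears. The middle slot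
  \<open>r *\<^sub>R \<Upsilon>\<close> supplies the opposite term because \<open>u\<close> is
  normal.\<close>

lemma pair_scale_tractor:
  assumes "u \<in> normal_space G F y"
  shows "bil hc I (NT u) = r * bil B H u"
proof -
  have "I $ Tsig = r" "(\<chi> a. I $ Tmu a) = r *\<^sub>R \<Upsilon>"
    using V by (simp_all add: I tractor_change_def Let_def \<Upsilon>_def vec_eq_iff)
  then have "bil hc I (NT u) = r * (bil B u H - bil B u gradN) + r * (u \<bullet> \<Upsilon>)"
    unfolding pair_normal_tractor mean_curvature_rescaled bil_linear(4)[symmetric]
    using \<omega> by (simp add: bil_linear(6,7) inner_commute)
  moreover have "bil B u gradN = u \<bullet> \<Upsilon>"
    using orth_proj_perp(2)[OF G subspace_tangent] assms bil_grad unfolding normal_space_eq by simp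
  ultimately show ?thesis
    by (simp add: bil_B_commute algebra_simps)
qed

text \<open>\<open>I\<close> pairs with the factor \<open>r\<close> and normal tractors with
  \<open>r\<^sup>2\<close>; the factor \<open>1 / r\<close> in \<open>w\<close> balances the
  two.\<close>

lemma pair_scale_tractor_normal_part:
  assumes "u \<in> normal_space G F y"
  shows "bil hc (I - w) (NT u) = 0"
  using \<omega> pair_scale_tractor[OF assms] pair_normal_tractors[of "(1 / r) *\<^sub>R H" u]
  by (simp add: bil_linear power2_eq_square)

lemma scaled_H_normal: "c *\<^sub>R H \<in> normal_space G F y"
  using mean_curvature_normal subspace_scale[OF subspace_bil_perp] unfolding normal_space_eq by blast

lemma w_eq_0_iff: "w = 0 \<longleftrightarrow> H = 0"
  using \<omega> unfolding normal_tractor_eq_0_iff by simp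

lemma scale_tractor_proj: "normal_tractor_proj Gc F y I = w"
  unfolding normal_tractor_proj_def normal_tractors_eq
proof (rule orth_proj_unique)
  show "subspace (NT ` normal_space G F y)"
    unfolding normal_space_eq
    by (rule linear_subspace_image[OF linear_normal_to_tractor subspace_bil_perp])
  \<comment> \<open>The tractor metric is indefinite, but normal tractors pair by a positive
    multiple of \<open>B\<close>.\<close>
  show "W = 0" if W: "W \<in> NT ` normal_space G F y" "bil hc W W = 0" for W
  proof -
    obtain u where "W = NT u" using W(1) by blast
    then show ?thesis
      using W(2) \<omega> posdef_eq_0_iff[OF G, of u] by (simp only: pair_normal_tractors normal_tractor_eq_0_iff) simp
  qed
qed (use scaled_H_normal pair_scale_tractor_normal_part in auto)

lemma scale_tractor_proj_eq_0_iff: "normal_tractor_proj Gc F y I = 0 \<longleftrightarrow> H = 0"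
  unfolding scale_tractor_proj by (rule w_eq_0_iff)

lemma scale_tractor_perp_iff: "I \<in> normal_tractors_perp Gc F y \<longleftrightarrow> H = 0"
proof
  assume "I \<in> normal_tractors_perp Gc F y"
  \<comment> \<open>Tested against the tractor of \<open>H\<close> itself, the pairing is
    \<open>r * bil B H H\<close>.\<close>
  then have "bil hc I (NT H) = 0"
    using mean_curvature_normal by (simp add: normal_tractors_perp_def normal_tractors_eq)
  then show "H = 0"
    using \<omega> posdef_eq_0_iff[OF G] by (simp add: pair_scale_tractor[OF mean_curvature_normal])
qed (simp add: normal_tractors_perp_def normal_tractors_eq pair_scale_tractor bil_linear)

text \<open>The factors \<open>r\<close> and \<open>1 / r\<close> cancel, so the pairing is the
  squared length of \<open>H\<close>. Symmetry of \<open>hc\<close> allows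
  \<open>pair_scale_tractor\<close> to be applied.\<close>

lemma pair_mean_curvature_tractor_iff: "bil hc w I = 0 \<longleftrightarrow> H = 0"
proof -
  have "transpose hc = hc"
  proof -
    have inv: "matrix_inv (Gc (F y)) = transpose (matrix_inv (Gc (F y)))"
    proof (rule matrix_inv_unique)
      have "transpose (matrix_inv (Gc (F y)) ** Gc (F y)) = transpose (mat 1)"
        using matrix_inv_works(2)[OF posdef_invertible[OF Gc_posdef]] by simp
      then show "Gc (F y) ** transpose (matrix_inv (Gc (F y))) = mat 1"
        using Gc_posdef by (simp only: matrix_transpose_mul transpose_mat posdef_def)
    qed
    then have sym: "matrix_inv (Gc (F y)) $ a $ b = matrix_inv (Gc (F y)) $ b $ a" for a b
    proof -
      have "matrix_inv (Gc (F y)) $ a $ b = transpose (matrix_inv (Gc (F y))) $ a $ b"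
        by (rule arg_cong[OF inv, of "\<lambda>A. A $ a $ b"])
      then show ?thesis by (simp only: transpose_def vec_lambda_beta)
    qed
    have "hc $ K $ L = hc $ L $ K" for K L
      by (cases K; cases L) (simp_all add: tractor_metric_def sym)
    then show ?thesis by (simp add: transpose_def vec_eq_iff)
  qed
  then have "bil hc w I = bil hc I w"
    by (rule bil_commute)
  also have "\<dots> = r * bil B H ((1 / r) *\<^sub>R H)"
    by (rule pair_scale_tractor[OF scaled_H_normal])
  also have "\<dots> = bil B H H"
    using \<omega> by (simp add: bil_linear)
  finally show ?thesis
    using posdef_eq_0_iff[OF G] by simp
qed

lemma contract_scale_tractor_iff:
  assumes N: "normal_tractor_form Gc F y N"
  shows "(\<forall>K. length K = CARD('n) - CARD('m) - 1 \<longrightarrow> contract (($) I) N K = 0) \<longleftrightarrow> H = 0"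
proof -
  \<comment> \<open>\<open>N\<close> is annihilated by the complement of the normal tractors, so it
    sees only the normal part \<open>w\<close> of \<open>I\<close>.\<close>
  have "I - w \<in> normal_tractors_perp Gc F y"
    by (auto simp: normal_tractors_perp_def normal_tractors_eq pair_scale_tractor_normal_part)
  then have "contract (($) (I - w)) N K = 0" if "length K = CARD('n) - CARD('m) - 1" for K
    using N that unfolding normal_tractor_form_def contract_def Let_def by blast
  then have contract_w: "contract (($) I) N K = contract (($) w) N K"
    if "length K = CARD('n) - CARD('m) - 1" for K
    using that by (simp add: contract_def left_diff_distrib sum_subtractf)
  have False if zero: "\<And>K. length K = CARD('n) - CARD('m) - 1 \<Longrightarrow> contract (($) w) N K = 0" and "H \<noteq> 0"
  proof -
    obtain c vs where "oriented_normal_frame G F y (c *\<^sub>R H # vs)"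
      using oriented_normal_frame_exists[OF G dim_tangent mean_curvature_normal \<open>H \<noteq> 0\<close>] by blast
    \<comment> \<open>A conformal change affects neither the normal space nor the determinant
      condition, so the frame is oriented in both scales.\<close>
    then have vs: "oriented_normal_frame Gc F y (c *\<^sub>R H # vs)"
      by (simp add: oriented_normal_frame_def normal_space_rescaled)
    then have "Suc (length vs) = CARD('n) - CARD('m)"
      by (simp add: oriented_normal_frame_def)
    then have len: "length vs = CARD('n) - CARD('m) - 1"
      by linarith
    \<comment> \<open>The first tractor of the frame is a multiple of \<open>w\<close>, so the
      assumed vanishing contraction makes the value of \<open>N\<close> on the whole frame
      0.\<close>
    have "NT (c *\<^sub>R H) = (c * r) *\<^sub>R w"
      using \<omega> by (simp flip: linear_cmul[OF linear_normal_to_tractor])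
    then have "contract (($) (NT (c *\<^sub>R H))) N K = (c * r) * contract (($) w) N K" for K
      by (simp add: contract_def sum_distrib_left mult_ac)
    then have "tensor_eval N (map NT (c *\<^sub>R H # vs)) = 0"
      using zero len by (simp add: tensor_eval_Cons)
    moreover have "tensor_eval N (map NT (c *\<^sub>R H # vs)) > 0"
      using N vs unfolding normal_tractor_form_def Let_def by blast
    ultimately show False by simp
  qed
  moreover have "contract (($) w) N K = 0" if "H = 0" for K
    using that w_eq_0_iff by (simp add: contract_def)
  ultimately show ?thesis
    using contract_w by auto
qed

end

end

section \<open>Minimal submanifolds\<close>

lemma smooth_on_differentiable:
  assumes "smooth_on U f" "x \<in> U"
  shows "f differentiable (at x)"
  using assms unfolding smooth_on_def by (metis Ck_on.simps(2))

lemma smooth_on_const: "smooth_on U (\<lambda>_. c)"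
proof -
  have "Ck_on k U (\<lambda>_ :: 'a. c :: 'b)" for k c
  proof (induction k arbitrary: c)
    case (Suc k)
    have "frechet_derivative (\<lambda>_ :: 'a. c) (at x) v = 0" for x v
      by (simp add: frechet_derivative_const)
    then show ?case using Suc by simp
  qed simp
  then show ?thesis by (simp add: smooth_on_def)
qed

lemma chart_inv_left:
  assumes "is_chart M c" "p \<in> fst c"
  shows "chart_inv c (snd c p) = p"
proof -
  have "topspace (subtopology M (fst c)) = fst c"
    using assms(1) openin_subset by (auto simp: is_chart_def)
  then have "inj_on (snd c) (fst c)"
    using assms(1) homeomorphic_imp_injective_map by (fastforce simp: is_chart_def)
  then show ?thesis
    using assms(2) by (simp add: chart_inv_def)
qed

lemma rescaled_eq: "rescaled \<Omega> g c = (\<lambda>z. ((\<Omega> \<circ> chart_inv c) z)\<^sup>2 *\<^sub>R g c z)"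
  by (simp add: rescaled_def weight_rep_def)

text \<open>This passes from the global hypotheses to the pointwise setting. The two equations
  ensure that quantities along the submanifold and in the ambient chart are evaluated at the same
  point.\<close>

lemma conformal_pointI:
  assumes M: "oriented_manifold M A" and g: "riemannian_metric A g"
    and S: "oriented_submanifold M A S AS" and \<Omega>: "conformal_factor M A \<Omega>"
    and cs: "c \<in> A" "s \<in> AS" "p \<in> S \<inter> fst c \<inter> fst s"
  shows "inclusion_in c s (snd s p) = snd c p" "chart_inv c (snd c p) = p"
    and "conformal_point (g c) (\<Omega> \<circ> chart_inv c) (inclusion_in c s) (snd s p)"
proof -
  have c: "is_chart M c" and s: "is_chart (subtopology M S) s"
    using M S cs by (auto simp: oriented_manifold_def oriented_submanifold_def)
  show p: "inclusion_in c s (snd s p) = snd c p"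
    using chart_inv_left[OF s] cs by (simp add: inclusion_in_def)
  show cp: "chart_inv c (snd c p) = p"
    using chart_inv_left[OF c] cs by simp
  have x: "snd c p \<in> snd c ` fst c" and y: "snd s p \<in> snd s ` (fst s \<inter> fst c)"
    using cs by auto
  have "p \<in> topspace M"
    using c cs openin_subset by (auto simp: is_chart_def)
  show "conformal_point (g c) (\<Omega> \<circ> chart_inv c) (inclusion_in c s) (snd s p)"
  proof (unfold_locales, unfold p)
    show "posdef (g c (snd c p))"
      using g cs x unfolding riemannian_metric_def posdef_def by blast
    have "g c differentiable (at (snd c p))"
      using g cs x smooth_on_differentiable unfolding riemannian_metric_def by blast
    then show "(\<lambda>z. g c z $ i $ j) differentiable (at (snd c p))" for i j
      unfolding differentiable_def
      using bounded_linear.has_derivative[OF bounded_linear_vec_nth]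
        bounded_linear.has_derivative[OF bounded_linear_vec_nth] by blast
    show "(\<Omega> \<circ> chart_inv c) differentiable (at (snd c p))"
      using \<Omega> cs x smooth_on_differentiable unfolding conformal_factor_def by blast
    show "(\<Omega> \<circ> chart_inv c) (snd c p) > 0"
      using \<Omega> cp \<open>p \<in> topspace M\<close> by (simp add: conformal_factor_def)
    show "inclusion_in c s differentiable (at (snd s p))"
      using S cs y smooth_on_differentiable unfolding oriented_submanifold_def by blast
    show "inj (frechet_derivative (inclusion_in c s) (at (snd s p)))"
      using S cs y unfolding oriented_submanifold_def by blast
  qed
qed

lemma scale_tractor_split_1:
  "scale_tractor_split G (\<lambda>_. 1) x $ Tsig = 1" "scale_tractor_split G (\<lambda>_. 1) x $ Tmu a = 0"
  by (simp_all add: scale_tractor_split_def pd_def frechet_derivative_const)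

text \<open>Minimality involves no choice of scale, while \<open>along\<close> ranges over all
  conformal factors. The constant factor 1 makes its quantification nonvacuous, so an equivalence at
  each point and in each scale suffices.\<close>

lemma minimal_iff_along:
  assumes "\<And>\<Omega> c s p. conformal_factor M A \<Omega> \<Longrightarrow> c \<in> A \<Longrightarrow> s \<in> AS \<Longrightarrow> p \<in> S \<inter> fst c \<inter> fst s \<Longrightarrow>
    Q \<Omega> c s p \<longleftrightarrow> mean_curvature (g c) (inclusion_in c s) (snd s p) = 0"
  shows "minimal_submanifold A g S AS \<longleftrightarrow> along M A S AS Q"
proof -
  have "conformal_factor M A (\<lambda>_. 1)"
    by (simp add: conformal_factor_def comp_def smooth_on_const)
  then show ?thesis
    unfolding minimal_submanifold_def along_def using assms by blast
qed

theorem corollary4p2: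
  fixes M :: "'a topology"
    and A :: "('a, 'n::{finite,linorder}) chart set"
    and g :: "('a, 'n) metric"
    and S :: "'a set"
    and AS :: "('a, 'm::{finite,linorder}) chart set"
    and N :: "('a \<Rightarrow> real) \<Rightarrow> ('a, 'n) chart \<Rightarrow> 'a \<Rightarrow> 'n tidx tensor"
  defines "d \<equiv> CARD('n) - CARD('m)"
    and "G \<equiv> \<lambda>\<Omega> c. rescaled \<Omega> g c"
    and "h \<equiv> \<lambda>\<Omega> c p. tractor_metric (rescaled \<Omega> g c) (snd c p)"
    and "I \<equiv> scale_tractor g"
  assumes "CARD('n) \<ge> 3"
    and "1 \<le> CARD('m)" and "CARD('m) \<le> CARD('n) - 1"
    and "oriented_manifold M A" and "connected_space M"
    and "riemannian_metric A g"
    and "oriented_submanifold M A S AS"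
    and "along M A S AS (\<lambda>\<Omega> c s p.
           normal_tractor_form (G \<Omega> c) (inclusion_in c s) (snd s p) (N \<Omega> c p))"
  shows
    "(minimal_submanifold A g S AS \<longleftrightarrow>
        along M A S AS (\<lambda>\<Omega> c s p.
          normal_tractor_proj (G \<Omega> c) (inclusion_in c s) (snd s p) (I \<Omega> c p) = 0)) \<and>
     (minimal_submanifold A g S AS \<longleftrightarrow>
        along M A S AS (\<lambda>\<Omega> c s p.
          \<forall>K. length K = d - 1 \<longrightarrow> (\<Sum>L\<in>UNIV. I \<Omega> c p $ L * N \<Omega> c p (L # K)) = 0)) \<and>
     (minimal_submanifold A g S AS \<longleftrightarrow>
        along M A S AS (\<lambda>\<Omega> c s p.
          \<forall>K. length K = CARD('m) + 3 \<longrightarrow>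
            skew (CARD('m) + 3)
              (\<lambda>K. I \<Omega> c p $ hd K * hodge_star (h \<Omega> c p) d (N \<Omega> c p) (tl K)) K = 0)) \<and>
     (minimal_submanifold A g S AS \<longleftrightarrow>
        along M A S AS (\<lambda>\<Omega> c s p.
          I \<Omega> c p \<in> normal_tractors_perp (G \<Omega> c) (inclusion_in c s) (snd s p))) \<and>
     (minimal_submanifold A g S AS \<longleftrightarrow>
        along M A S AS (\<lambda>\<Omega> c s p.
          bil (h \<Omega> c p) (mean_curvature_tractor g \<Omega> c s p) (I \<Omega> c p) = 0))"
proof (intro conjI; rule minimal_iff_along)
  fix \<Omega> c s p
  assume \<Omega>: "conformal_factor M A \<Omega>" and cs: "c \<in> A" "s \<in> AS" "p \<in> S \<inter> fst c \<inter> fst s"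
  define \<omega> where "\<omega> = \<Omega> \<circ> chart_inv c"
  define F where "F = inclusion_in c s"
  define y where "y = snd s p"
  \<comment> \<open>In the splitting by \<open>g\<close> itself the scale density is the constant 1,
    so its first derivatives vanish.\<close>
  define V where "V = scale_tractor_split (g c) (\<lambda>_. 1) (snd c p)"
  note point = conformal_pointI[OF \<open>oriented_manifold M A\<close> \<open>riemannian_metric A g\<close>
      \<open>oriented_submanifold M A S AS\<close> \<Omega> cs]
  have Fy: "F y = snd c p"
    using point(1) by (simp add: F_def y_def)
  interpret conformal_point "g c" \<omega> F y
    using point(3) by (simp add: \<omega>_def F_def y_def)
  have V: "V $ Tsig = 1" "V $ Tmu a = 0" for a
    by (simp_all add: V_def scale_tractor_split_1)
  have "scale_density (\<lambda>_. 1) \<circ> chart_inv c = (\<lambda>_. 1)"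
    by (simp add: scale_density_def weight_rep_def comp_def)
  then have I: "I \<Omega> c p = tractor_change (g c) \<omega> (F y) V"
    by (simp add: I_def scale_tractor_def V_def \<omega>_def Fy)
  have G: "G \<Omega> c = Gc"
    by (simp add: G_def rescaled_eq \<omega>_def)
  have h: "h \<Omega> c p = hc"
    unfolding h_def Fy G[unfolded G_def] ..
  have "\<omega> (F y) = \<Omega> p"
    using point(2) by (simp add: Fy \<omega>_def)
  \<comment> \<open>The weights 1 and -2 combine to a single division by the value of the conformal
    factor.\<close>
  then have "scale_density \<Omega> p *\<^sub>R weight_rep (- 2) \<Omega> p v = (1 / \<omega> (F y)) *\<^sub>R v" for v :: "'n coords"
    using \<omega> by (simp add: scale_density_def weight_rep_def power_int_minus power2_eq_square field_simps)
  then have mct: "mean_curvature_tractor g \<Omega> c s p = w"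
    unfolding mean_curvature_tractor_def Let_def G[unfolded G_def] F_def[symmetric] y_def[symmetric]
    by (simp only:)
  have N: "normal_tractor_form Gc F y (N \<Omega> c p)"
    using \<open>along M A S AS _\<close> \<Omega> cs unfolding along_def F_def y_def G[symmetric] by blast
  show "normal_tractor_proj (G \<Omega> c) (inclusion_in c s) (snd s p) (I \<Omega> c p) = 0 \<longleftrightarrow>
      mean_curvature (g c) (inclusion_in c s) (snd s p) = 0"
    using scale_tractor_proj_eq_0_iff[OF V I] by (simp only: G F_def y_def)
  show "I \<Omega> c p \<in> normal_tractors_perp (G \<Omega> c) (inclusion_in c s) (snd s p) \<longleftrightarrow>
      mean_curvature (g c) (inclusion_in c s) (snd s p) = 0"
    using scale_tractor_perp_iff[OF V I] by (simp only: G F_def y_def)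
  show "bil (h \<Omega> c p) (mean_curvature_tractor g \<Omega> c s p) (I \<Omega> c p) = 0 \<longleftrightarrow>
      mean_curvature (g c) (inclusion_in c s) (snd s p) = 0"
    using pair_mean_curvature_tractor_iff[OF V I] unfolding h mct by (simp only: F_def y_def)
  have contract: "(\<forall>K. length K = d - 1 \<longrightarrow> contract (($) (I \<Omega> c p)) (N \<Omega> c p) K = 0) \<longleftrightarrow>
      mean_curvature (g c) (inclusion_in c s) (snd s p) = 0"
    using contract_scale_tractor_iff[OF V I N] by (simp only: d_def F_def y_def)
  then show "(\<forall>K. length K = d - 1 \<longrightarrow> (\<Sum>L\<in>UNIV. I \<Omega> c p $ L * N \<Omega> c p (L # K)) = 0) \<longleftrightarrow>
      mean_curvature (g c) (inclusion_in c s) (snd s p) = 0"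
    by (simp only: contract_def)
  \<comment> \<open>The bound on \<open>CARD('m)\<close> gives \<open>d \<ge> 1\<close>, so
    subtracting 1 is exact. In dimension \<open>n + 2\<close> the star of a \<open>d\<close>-form
    has \<open>m + 2\<close> indices.\<close>
  have d: "Suc (d - 1) = d" "Suc (d - 1) + (CARD('m) + 2) = CARD('n tidx)"
    using assms(5-7) by (simp_all add: d_def card_tidx)
  have "alternating d (N \<Omega> c p)"
    using N unfolding normal_tractor_form_def Let_def d_def by blast
  then have alt: "alternating (Suc (d - 1)) (N \<Omega> c p)"
    by (simp only: d(1))
  have "invertible (h \<Omega> c p)"
    unfolding h by (rule tractor_metric_invertible, rule posdef_invertible, rule Gc_posdef)
  \<comment> \<open>The index of \<open>I\<close> is added to the \<open>m + 2\<close> indices of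
    the star.\<close>
  moreover have "Suc (CARD('m) + 2) = CARD('m) + 3" by simp
  ultimately show "(\<forall>K. length K = CARD('m) + 3 \<longrightarrow>
            skew (CARD('m) + 3)
              (\<lambda>K. I \<Omega> c p $ hd K * hodge_star (h \<Omega> c p) d (N \<Omega> c p) (tl K)) K = 0) \<longleftrightarrow>
      mean_curvature (g c) (inclusion_in c s) (snd s p) = 0"
    using skew_hodge_star_eq_0_iff[OF alt d(2), of "h \<Omega> c p" "I \<Omega> c p"] contract
    by (simp only: d(1))
qed

end
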